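(* There is a complete noncompact strongly stable constant-mean-curvature embedding of a $6$-dimensional manifold into $\mathbb H^7(-1)$ with $H^2=\dfrac{49}{48}$.
   Context: For a smooth two-sided immersion $F:(M^n,g)\to\mathbb H^{n+1}(-1)$ with induced metric $g$ and chosen unit normal $N$: $A(X,Y)=\langle\bar\nabla_{dF(X)}N,dF(Y)\rangle$, the averaged mean curvature is $H=\frac1n\operatorname{tr}_gA$ (constant mean curvature means $H$ constant), and strongly stable means $$Q_{-1}(f)=\int_M\bigl(|\nabla f|^2-(|A|^2-n)f^2\bigr)\,dV_g\ge0\qquad\text{for all }f\in C_c^\infty(M).$$ Complete refers to the induced metric; manifolds are smooth, connected and without boundary. Here $n=6$. *)

theory Defs
  imports "HOL-Analysis.Analysis"
begin

section \<open>Smooth maps between open subsets of Euclidean spaces\<close>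

primrec Ck_on :: "nat \<Rightarrow> 'a::euclidean_space set \<Rightarrow> ('a \<Rightarrow> 'b::euclidean_space) \<Rightarrow> bool" where
  "Ck_on 0 S f \<longleftrightarrow> continuous_on S f"
| "Ck_on (Suc k) S f \<longleftrightarrow> (\<forall>x\<in>S. f differentiable (at x)) \<and>
     (\<forall>v. Ck_on k S (\<lambda>x. frechet_derivative f (at x) v))"

definition smooth_on :: "'a::euclidean_space set \<Rightarrow> ('a \<Rightarrow> 'b::euclidean_space) \<Rightarrow> bool" where
  "smooth_on S f \<longleftrightarrow> (\<forall>k. Ck_on k S f)"


section \<open>Smooth manifolds\<close>

text \<open>A chart is a pair of a domain and a coordinate map. A smooth manifold of dimension
  \<open>CARD('n)\<close> is an abstract topology (its points form the set \<open>topspace X\<close>) with a smooth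
  atlas; the atlas need not be maximal, it only has to determine the smooth structure. The type
  \<open>'p\<close> merely supplies labels for the points: a topology or metric it may carry itself plays no
  role.\<close>

type_synonym ('p, 'n) chart = "'p set \<times> ('p \<Rightarrow> real ^ 'n)"

definition param :: "('p, 'n) chart \<Rightarrow> real ^ 'n \<Rightarrow> 'p" where
  "param c = inv_into (fst c) (snd c)"

definition smooth_manifold :: "'p topology \<Rightarrow> ('p, 'n::finite) chart set \<Rightarrow> bool" where
  "smooth_manifold X \<A> \<longleftrightarrow>
     Hausdorff_space X \<and> second_countable X \<and>
     (\<forall>(U, \<phi>)\<in>\<A>. openin X U \<and> open (\<phi> ` U) \<and>
        homeomorphic_map (subtopology X U) (top_of_set (\<phi> ` U)) \<phi>) \<and>
     (\<Union>(U, \<phi>)\<in>\<A>. U) = topspace X \<and>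
     (\<forall>(U, \<phi>)\<in>\<A>. \<forall>(V, \<psi>)\<in>\<A>. smooth_on (\<phi> ` (U \<inter> V)) (\<psi> \<circ> param (U, \<phi>)))"

definition smooth_map ::
  "('p, 'n::finite) chart set \<Rightarrow> ('p \<Rightarrow> 'b::euclidean_space) \<Rightarrow> bool" where
  "smooth_map \<A> f \<longleftrightarrow> (\<forall>(U, \<phi>)\<in>\<A>. smooth_on (\<phi> ` U) (f \<circ> param (U, \<phi>)))"

text \<open>Pointwise geometric quantities are computed in some chart around the point. All those
  below are invariant under change of coordinates, so the choice is immaterial.\<close>

definition chart_at :: "('p, 'n) chart set \<Rightarrow> 'p \<Rightarrow> ('p, 'n) chart" where
  "chart_at \<A> p = (SOME c. c \<in> \<A> \<and> p \<in> fst c)"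

text \<open>Differential, in the chart \<open>c\<close>, of a map into a vector space: \<open>v\<close> is a tangent vector
  given by its coordinates.\<close>

definition dmap :: "('p, 'n::finite) chart \<Rightarrow> ('p \<Rightarrow> 'b::euclidean_space) \<Rightarrow> 'p \<Rightarrow> real ^ 'n \<Rightarrow> 'b"
  where "dmap c f p v = frechet_derivative (f \<circ> param c) (at (snd c p)) v"


section \<open>Hyperbolic space of curvature \<open>-1\<close>\<close>

text \<open>The hyperboloid model in Minkowski space; its dimension is \<open>DIM('e)\<close>. The Riemannian metric
  of hyperbolic space is the restriction of the Lorentz product to the tangent spaces
  \<open>{v. lorentz x v = 0}\<close>.\<close>

definition lorentz :: "real \<times> 'e::euclidean_space \<Rightarrow> real \<times> 'e \<Rightarrow> real" where
  "lorentz x y = snd x \<bullet> snd y - fst x * fst y"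

definition hyperbolic_space :: "(real \<times> 'e::euclidean_space) set" where
  "hyperbolic_space = {x. lorentz x x = -1 \<and> fst x > 0}"

text \<open>Lorentz-orthogonal projection of Minkowski space onto the tangent space at the point
  \<open>x\<close>. The Levi-Civita connection of hyperbolic space is the tangential part of the flat
  derivative.\<close>

definition tangential :: "real \<times> 'e::euclidean_space \<Rightarrow> real \<times> 'e \<Rightarrow> real \<times> 'e" where
  "tangential x w = w + lorentz w x *\<^sub>R x"


section \<open>Immersed hypersurfaces of hyperbolic space\<close>

definition smooth_immersion ::
  "'p topology \<Rightarrow> ('p, 'n::finite) chart set \<Rightarrow> ('p \<Rightarrow> real \<times> 'e::euclidean_space) \<Rightarrow> bool" where
  "smooth_immersion X \<A> F \<longleftrightarrow>
     F ` topspace X \<subseteq> hyperbolic_space \<and> smooth_map \<A> F \<and>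
     (\<forall>c\<in>\<A>. \<forall>p\<in>fst c. inj (dmap c F p))"

definition smooth_embedding ::
  "'p topology \<Rightarrow> ('p, 'n::finite) chart set \<Rightarrow> ('p \<Rightarrow> real \<times> 'e::euclidean_space) \<Rightarrow> bool" where
  "smooth_embedding X \<A> F \<longleftrightarrow>
     smooth_immersion X \<A> F \<and> embedding_map X (top_of_set hyperbolic_space) F"

definition unit_normal ::
  "'p topology \<Rightarrow> ('p, 'n::finite) chart set \<Rightarrow> ('p \<Rightarrow> real \<times> 'e::euclidean_space) \<Rightarrow>
     ('p \<Rightarrow> real \<times> 'e) \<Rightarrow> bool" where
  "unit_normal X \<A> F N \<longleftrightarrow> smooth_map \<A> N \<and>
     (\<forall>p\<in>topspace X. lorentz (N p) (F p) = 0 \<and> lorentz (N p) (N p) = 1) \<and>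
     (\<forall>c\<in>\<A>. \<forall>p\<in>fst c. \<forall>v. lorentz (N p) (dmap c F p v) = 0)"

text \<open>The induced metric \<open>g\<close> and the second fundamental form
  \<open>A(v,w) = \<langle>\<nabla>\<^bsub>dF(v)\<^esub> N, dF(w)\<rangle>\<close> in the chart \<open>c\<close>, and their coordinate matrices.\<close>

definition ind_metric ::
  "('p, 'n::finite) chart \<Rightarrow> ('p \<Rightarrow> real \<times> 'e::euclidean_space) \<Rightarrow> 'p \<Rightarrow>
     real ^ 'n \<Rightarrow> real ^ 'n \<Rightarrow> real" where
  "ind_metric c F p v w = lorentz (dmap c F p v) (dmap c F p w)"

definition second_form ::
  "('p, 'n::finite) chart \<Rightarrow> ('p \<Rightarrow> real \<times> 'e::euclidean_space) \<Rightarrow> ('p \<Rightarrow> real \<times> 'e) \<Rightarrow> 'p \<Rightarrow>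
     real ^ 'n \<Rightarrow> real ^ 'n \<Rightarrow> real" where
  "second_form c F N p v w = lorentz (tangential (F p) (dmap c N p v)) (dmap c F p w)"

definition gram ::
  "('p, 'n::finite) chart \<Rightarrow> ('p \<Rightarrow> real \<times> 'e::euclidean_space) \<Rightarrow> 'p \<Rightarrow> real ^ 'n ^ 'n" where
  "gram c F p = (\<chi> i j. ind_metric c F p (axis i 1) (axis j 1))"

definition second_form_matrix ::
  "('p, 'n::finite) chart \<Rightarrow> ('p \<Rightarrow> real \<times> 'e::euclidean_space) \<Rightarrow> ('p \<Rightarrow> real \<times> 'e) \<Rightarrow> 'p \<Rightarrow>
     real ^ 'n ^ 'n" where
  "second_form_matrix c F N p = (\<chi> i j. second_form c F N p (axis i 1) (axis j 1))"

text \<open>\<open>H = (1/n) g\<^sup>i\<^sup>j A\<^sub>i\<^sub>j\<close>\<close>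

definition mean_curvature ::
  "('p, 'n::finite) chart set \<Rightarrow> ('p \<Rightarrow> real \<times> 'e::euclidean_space) \<Rightarrow> ('p \<Rightarrow> real \<times> 'e) \<Rightarrow>
     'p \<Rightarrow> real" where
  "mean_curvature \<A> F N p =
     (let c = chart_at \<A> p; gi = matrix_inv (gram c F p); a = second_form_matrix c F N p
      in (\<Sum>i\<in>UNIV. \<Sum>j\<in>UNIV. gi $ i $ j * a $ i $ j) / real CARD('n))"

text \<open>\<open>|A|\<^sup>2 = g\<^sup>i\<^sup>k g\<^sup>j\<^sup>l A\<^sub>i\<^sub>j A\<^sub>k\<^sub>l\<close>\<close>

definition norm_second_form_sq ::
  "('p, 'n::finite) chart set \<Rightarrow> ('p \<Rightarrow> real \<times> 'e::euclidean_space) \<Rightarrow> ('p \<Rightarrow> real \<times> 'e) \<Rightarrow>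
     'p \<Rightarrow> real" where
  "norm_second_form_sq \<A> F N p =
     (let c = chart_at \<A> p; gi = matrix_inv (gram c F p); a = second_form_matrix c F N p
      in \<Sum>i\<in>UNIV. \<Sum>j\<in>UNIV. \<Sum>k\<in>UNIV. \<Sum>l\<in>UNIV.
           gi $ i $ k * gi $ j $ l * a $ i $ j * a $ k $ l)"

text \<open>\<open>|\<nabla>f|\<^sup>2 = g\<^sup>i\<^sup>j \<partial>\<^sub>i f \<partial>\<^sub>j f\<close>\<close>

definition norm_grad_sq ::
  "('p, 'n::finite) chart set \<Rightarrow> ('p \<Rightarrow> real \<times> 'e::euclidean_space) \<Rightarrow> ('p \<Rightarrow> real) \<Rightarrow>
     'p \<Rightarrow> real" where
  "norm_grad_sq \<A> F f p =
     (let c = chart_at \<A> p; gi = matrix_inv (gram c F p)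
      in \<Sum>i\<in>UNIV. \<Sum>j\<in>UNIV. gi $ i $ j * dmap c f p (axis i 1) * dmap c f p (axis j 1))"


section \<open>Completeness of the induced metric\<close>

definition piecewise_C1_curve ::
  "'p topology \<Rightarrow> ('p, 'n::finite) chart set \<Rightarrow> (real \<Rightarrow> 'p) \<Rightarrow> bool" where
  "piecewise_C1_curve X \<A> \<gamma> \<longleftrightarrow> continuous_map (top_of_set {0..1}) X \<gamma> \<and>
     (\<exists>S. finite S \<and>
        (\<forall>(U, \<phi>)\<in>\<A>. (\<phi> \<circ> \<gamma>) C1_differentiable_on {t \<in> {0..1} - S. \<gamma> t \<in> U}))"

definition speed ::
  "('p, 'n::finite) chart set \<Rightarrow> ('p \<Rightarrow> real \<times> 'e::euclidean_space) \<Rightarrow> (real \<Rightarrow> 'p) \<Rightarrow>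
     real \<Rightarrow> real" where
  "speed \<A> F \<gamma> t =
     (let c = chart_at \<A> (\<gamma> t); v = vector_derivative (snd c \<circ> \<gamma>) (at t)
      in sqrt (ind_metric c F (\<gamma> t) v v))"

text \<open>As in the library notion \<^const>\<open>piecewise_C1_differentiable_on\<close>, the derivative of a
  piecewise \<open>C\<^sup>1\<close> curve may be unbounded near the finitely many exceptional times. Such a curve
  can have infinite length, hence the extended nonnegative integral.\<close>

definition curve_length ::
  "('p, 'n::finite) chart set \<Rightarrow> ('p \<Rightarrow> real \<times> 'e::euclidean_space) \<Rightarrow> (real \<Rightarrow> 'p) \<Rightarrow>
     ennreal" where
  "curve_length \<A> F \<gamma> = (\<integral>\<^sup>+t\<in>{0..1}. ennreal (speed \<A> F \<gamma> t) \<partial>lborel)"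

definition riemannian_dist ::
  "'p topology \<Rightarrow> ('p, 'n::finite) chart set \<Rightarrow> ('p \<Rightarrow> real \<times> 'e::euclidean_space) \<Rightarrow>
     'p \<Rightarrow> 'p \<Rightarrow> ennreal" where
  "riemannian_dist X \<A> F p q =
     (INF \<gamma>\<in>{\<gamma>. piecewise_C1_curve X \<A> \<gamma> \<and> \<gamma> 0 = p \<and> \<gamma> 1 = q}. curve_length \<A> F \<gamma>)"

definition complete_induced_metric ::
  "'p topology \<Rightarrow> ('p, 'n::finite) chart set \<Rightarrow> ('p \<Rightarrow> real \<times> 'e::euclidean_space) \<Rightarrow> bool" where
  "complete_induced_metric X \<A> F \<longleftrightarrow>
     (\<forall>\<sigma>::nat \<Rightarrow> 'p. range \<sigma> \<subseteq> topspace X \<and>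
        (\<forall>\<epsilon>>0. \<exists>k. \<forall>i\<ge>k. \<forall>j\<ge>k. riemannian_dist X \<A> F (\<sigma> i) (\<sigma> j) < \<epsilon>) \<longrightarrow>
        (\<exists>p\<in>topspace X. (\<lambda>i. riemannian_dist X \<A> F (\<sigma> i) p) \<longlonglongrightarrow> 0))"


section \<open>Riemannian volume and strong stability\<close>

text \<open>The Riemannian volume is the Borel measure whose density in every chart is
  \<open>sqrt (det g\<^sub>i\<^sub>j)\<close>; it exists and is unique because countably many charts cover the manifold.\<close>

definition is_riemannian_volume ::
  "'p topology \<Rightarrow> ('p, 'n::finite) chart set \<Rightarrow> ('p \<Rightarrow> real \<times> 'e::euclidean_space) \<Rightarrow>
     'p measure \<Rightarrow> bool" where
  "is_riemannian_volume X \<A> F \<mu> \<longleftrightarrow>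
     space \<mu> = topspace X \<and> sets \<mu> = sigma_sets (topspace X) {U. openin X U} \<and>
     (\<forall>(U, \<phi>)\<in>\<A>. \<forall>B\<in>sets \<mu>. B \<subseteq> U \<longrightarrow>
        emeasure \<mu> B =
          (\<integral>\<^sup>+x\<in>\<phi> ` B. ennreal (sqrt (det (gram (U, \<phi>) F (param (U, \<phi>) x)))) \<partial>lborel))"

definition riemannian_volume ::
  "'p topology \<Rightarrow> ('p, 'n::finite) chart set \<Rightarrow> ('p \<Rightarrow> real \<times> 'e::euclidean_space) \<Rightarrow>
     'p measure" where
  "riemannian_volume X \<A> F = (THE \<mu>. is_riemannian_volume X \<A> F \<mu>)"

definition test_function ::
  "'p topology \<Rightarrow> ('p, 'n::finite) chart set \<Rightarrow> ('p \<Rightarrow> real) \<Rightarrow> bool" where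
  "test_function X \<A> f \<longleftrightarrow> smooth_map \<A> f \<and>
     (\<exists>K. compactin X K \<and> (\<forall>p\<in>topspace X - K. f p = 0))"

definition strongly_stable ::
  "'p topology \<Rightarrow> ('p, 'n::finite) chart set \<Rightarrow> ('p \<Rightarrow> real \<times> 'e::euclidean_space) \<Rightarrow>
     ('p \<Rightarrow> real \<times> 'e) \<Rightarrow> bool" where
  "strongly_stable X \<A> F N \<longleftrightarrow>
     (\<forall>f. test_function X \<A> f \<longrightarrow>
        (\<integral>p. norm_grad_sq \<A> F f p - (norm_second_form_sq \<A> F N p - real CARD('n)) * (f p)\<^sup>2
           \<partial>riemannian_volume X \<A> F) \<ge> 0)"

end

(* The hypersurface is the tube H^3(2) x S^3(sqrt 3) of points of H^7 at distance s from a totally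
   geodesic H^3, with cosh s = 2 and sinh s = sqrt 3. Its principal curvatures are
   tanh s = sqrt 3 / 2 and coth s = 2 / sqrt 3, three times each, so H = 7 sqrt 3 / 12 and
   |A|^2 - 6 = 1 / 4, which is exactly the bottom of the spectrum of H^3 scaled by 2.
   Since S^3 x (0, oo) is R^4 minus the origin, half-space coordinates on H^3 turn the tube into the
   open set {(y, z) in R^4 x R^2. y <> 0} with metric (3 |dy|^2 + d|y|^2 + 4 |dz|^2) / |y|^2: a single
   chart suffices. The volume density is a multiple of |y|^(-6), and stability reduces to the
   one-dimensional Hardy inequality along the rays in y. *)
theory Submission
  imports Defs
begin

section \<open>Smooth maps\<close>

text \<open>With X in H^3 and Y in S^3, the tube at distance s is F = cosh s X + sinh s Y and its
  normal is N = sinh s X + cosh s Y, so one family \<open>G a b\<close> and its Lorentz products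
  serve both. The choice of s is a threshold: |A|^2 - 6 = 3 (coth s - tanh s)^2 = 3 / (sinh s cosh
  s)^2, whereas H^3 scaled by cosh s has bottom of spectrum 1 / (cosh s)^2, and the potential stays
  below it exactly when (sinh s)^2 >= 3. Equality leaves no room, so the Hardy inequality is needed
  with its sharp constant. Along a ray, with rho = |y|, the volume becomes a multiple of rho^(-3) d
  rho; the positive solution f = rho of the critical equation satisfies rho f' = f, and this
  dictates which square is discarded. The chart also simplifies the algebra: the product metric of
  H^3 x S^3 becomes |dx|^2 / |y|^2, which is conformally Euclidean. Hence the matrix of the second
  fundamental form is pointwise a multiple of the identity, and the induced metric is diagonal plus
  rank one.\<close>

lemma Ck_on_imp_continuous_on: "Ck_on k S f \<Longrightarrow> continuous_on S f"
  by (cases k) (auto intro!: continuous_at_imp_continuous_on differentiable_imp_continuous_within)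

lemma Ck_on_SucD: "Ck_on (Suc k) S f \<Longrightarrow> Ck_on k S f"
proof (induction k arbitrary: f)
  case 0
  then show ?case using Ck_on_imp_continuous_on by fastforce
next
  case (Suc k)
  then show ?case by (auto simp del: Ck_on.simps(1) dest: Suc.IH)
qed

text \<open>Openness is essential: \<open>frechet_derivative\<close> at x looks at a full
  neighbourhood of x, so agreement on S passes to derivatives only at interior points. The main use
  is \<open>f \<circ> param c\<close>, which agrees with f only on the chart domain.\<close>

lemma Ck_on_cong:
  assumes "open S" "\<And>x. x \<in> S \<Longrightarrow> f x = g x" "Ck_on k S f"
  shows "Ck_on k S g"
  using assms(2,3)
proof (induction k arbitrary: f g)
  case 0
  then show ?case by (simp cong: continuous_on_cong)
next
  case (Suc k)
  have d: "(f has_derivative frechet_derivative f (at x)) (at x)" if "x \<in> S" for x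
    using Suc.prems(2) that frechet_derivative_works by auto
  have e: "(g has_derivative frechet_derivative f (at x)) (at x)" if "x \<in> S" for x
    using has_derivative_transform_within_open[OF d[OF that] assms(1) that] Suc.prems(1) by auto
  have "frechet_derivative f (at x) v = frechet_derivative g (at x) v" if "x \<in> S" for x v
    using frechet_derivative_at[OF e[OF that]] by simp
  then have "Ck_on k S (\<lambda>x. frechet_derivative g (at x) v)" for v
    using Suc.IH[of "\<lambda>x. frechet_derivative f (at x) v"] Suc.prems(2) by simp
  then show ?case using e by (auto simp: differentiable_def)
qed

text \<open>Replaces the choice operator \<open>frechet_derivative\<close> by any explicit
  derivative. Together with the converse \<open>Ck_on_SucE\<close> it keeps the choice out of the
  inductions below.\<close>

lemma Ck_on_SucI:
  assumes "open S" "\<And>x. x \<in> S \<Longrightarrow> (f has_derivative D x) (at x)" "\<And>v. Ck_on k S (\<lambda>x. D x v)"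
  shows "Ck_on (Suc k) S f"
proof -
  have "D x v = frechet_derivative f (at x) v" if "x \<in> S" for x v
    using frechet_derivative_at[OF assms(2)[OF that]] by simp
  then have "Ck_on k S (\<lambda>x. frechet_derivative f (at x) v)" for v
    using Ck_on_cong[OF assms(1) _ assms(3)[of v]] by simp
  then show ?thesis using assms(2) by (auto simp: differentiable_def)
qed

lemma Ck_on_SucE:
  assumes "Ck_on (Suc k) S f"
  obtains D where "\<And>x. x \<in> S \<Longrightarrow> (f has_derivative D x) (at x)" "\<And>v. Ck_on k S (\<lambda>x. D x v)"
  using assms that[of "\<lambda>x. frechet_derivative f (at x)"] frechet_derivative_works by auto

lemma Ck_on_const: "open S \<Longrightarrow> Ck_on k S (\<lambda>x. c)"
proof (induction k arbitrary: c)
  case (Suc k)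
  then show ?case by (intro Ck_on_SucI[where D = "\<lambda>x v. 0"]) auto
qed simp

lemma Ck_on_bounded_linear:
  assumes "open S" "bounded_linear f"
  shows "Ck_on k S f"
proof (cases k)
  case 0
  then show ?thesis
    using assms(2) by (simp add: linear_continuous_on)
next
  case (Suc k)
  then show ?thesis
    using assms by (auto intro!: Ck_on_SucI[where D = "\<lambda>x. f"] Ck_on_const
        bounded_linear_imp_has_derivative simp del: Ck_on.simps)
qed

lemma Ck_on_add:
  assumes "open S" "Ck_on k S f" "Ck_on k S g"
  shows "Ck_on k S (\<lambda>x. f x + g x)"
  using assms(2,3)
proof (induction k arbitrary: f g)
  case 0
  then show ?case by (simp add: continuous_on_add)
next
  case (Suc k)
  obtain D where D: "\<And>x. x \<in> S \<Longrightarrow> (f has_derivative D x) (at x)" "\<And>v. Ck_on k S (\<lambda>x. D x v)"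
    using Ck_on_SucE[OF Suc.prems(1)] by blast
  obtain D' where D': "\<And>x. x \<in> S \<Longrightarrow> (g has_derivative D' x) (at x)" "\<And>v. Ck_on k S (\<lambda>x. D' x v)"
    using Ck_on_SucE[OF Suc.prems(2)] by blast
  show ?case
    by (rule Ck_on_SucI[where D = "\<lambda>x v. D x v + D' x v", OF assms(1)])
      (auto intro!: derivative_eq_intros D D' Suc.IH)
qed

text \<open>The product rule drives the induction. The derivative also contains f and g
  undifferentiated, so \<open>Ck_on_SucD\<close> has to lower their order by one.\<close>

lemma Ck_on_bilinear:
  assumes "bounded_bilinear h" "open S" "Ck_on k S f" "Ck_on k S g"
  shows "Ck_on k S (\<lambda>x. h (f x) (g x))"
  using assms(3,4)
proof (induction k arbitrary: f g)
  case 0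
  then show ?case by (simp add: bounded_bilinear.continuous_on[OF assms(1)])
next
  case (Suc k)
  obtain D where D: "\<And>x. x \<in> S \<Longrightarrow> (f has_derivative D x) (at x)" "\<And>v. Ck_on k S (\<lambda>x. D x v)"
    using Ck_on_SucE[OF Suc.prems(1)] by blast
  obtain D' where D': "\<And>x. x \<in> S \<Longrightarrow> (g has_derivative D' x) (at x)" "\<And>v. Ck_on k S (\<lambda>x. D' x v)"
    using Ck_on_SucE[OF Suc.prems(2)] by blast
  show ?case
  proof (rule Ck_on_SucI[where D = "\<lambda>x v. h (f x) (D' x v) + h (D x v) (g x)", OF assms(2)])
    show "((\<lambda>x. h (f x) (g x)) has_derivative (\<lambda>v. h (f x) (D' x v) + h (D x v) (g x))) (at x)"
      if "x \<in> S" for x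
      using bounded_bilinear.FDERIV[OF assms(1) D(1)[OF that] D'(1)[OF that]] .
    show "Ck_on k S (\<lambda>x. h (f x) (D' x v) + h (D x v) (g x))" for v
      by (intro Ck_on_add assms(2) Suc.IH D D' Ck_on_SucD[OF Suc.prems(1)] Ck_on_SucD[OF Suc.prems(2)])
  qed
qed

lemma smooth_on_cong:
  assumes "open S" "\<And>x. x \<in> S \<Longrightarrow> f x = g x"
  shows "smooth_on S f \<longleftrightarrow> smooth_on S g"
  unfolding smooth_on_def using Ck_on_cong[of S f g] Ck_on_cong[of S g f] assms by auto

lemma smooth_on_imp_continuous_on_derivative:
  assumes "smooth_on S f"
  shows "continuous_on S f"
    and "\<And>x. x \<in> S \<Longrightarrow> (f has_derivative frechet_derivative f (at x)) (at x)"
    and "\<And>v. continuous_on S (\<lambda>x. frechet_derivative f (at x) v)"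
  using assms[unfolded smooth_on_def, rule_format, of 0] assms[unfolded smooth_on_def, rule_format, of 1]
  by (auto simp: frechet_derivative_works)

lemma lorentz_commute: "lorentz x y = lorentz y x"
  by (simp add: lorentz_def inner_commute)

lemma lorentz_simps:
  "lorentz (x - y) z = lorentz x z - lorentz y z" "lorentz z (x - y) = lorentz z x - lorentz z y"
  "lorentz (c *\<^sub>R x) z = c * lorentz x z" "lorentz z (c *\<^sub>R x) = c * lorentz z x"
  by (simp_all add: lorentz_def inner_diff_left inner_diff_right algebra_simps)

section \<open>Manifolds with a single identity chart\<close>

lemma param_id: "x \<in> S \<Longrightarrow> param (S, id) x = x"
  by (simp add: param_def inv_into_def) (metis (mono_tags, lifting) someI)

lemma chart_at_singleton: "p \<in> fst c \<Longrightarrow> chart_at {c} p = c"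
  unfolding chart_at_def by (rule some_equality) auto

lemma smooth_on_comp_param:
  "open S \<Longrightarrow> smooth_on S (f \<circ> param (S, id)) \<longleftrightarrow> smooth_on S f"
  by (rule smooth_on_cong) (simp_all add: param_id)

lemma smooth_map_open: "open S \<Longrightarrow> smooth_map {(S, id)} f \<longleftrightarrow> smooth_on S f"
  by (simp add: smooth_map_def smooth_on_comp_param)

lemma smooth_on_id: "open S \<Longrightarrow> smooth_on S id"
  unfolding smooth_on_def id_def by (simp add: Ck_on_bounded_linear bounded_linear_ident)

lemma second_countable_euclidean: "second_countable (euclidean :: 'a::second_countable_topology topology)"
proof -
  obtain B :: "'a set set" where "countable B" "\<And>C. C \<in> B \<Longrightarrow> open C"
    and ex: "\<And>S. open S \<Longrightarrow> \<exists>U. U \<subseteq> B \<and> S = \<Union>U"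
    by (rule univ_second_countable) blast
  moreover have "\<exists>V\<in>B. x \<in> V \<and> V \<subseteq> U" if "open U" "x \<in> U" for U x
    using ex[OF that(1)] that(2) by auto
  ultimately show ?thesis by (auto simp: second_countable_def)
qed

lemma smooth_manifold_open:
  assumes "open S"
  shows "smooth_manifold (top_of_set S) {(S, id)}"
  unfolding smooth_manifold_def
  using assms smooth_on_comp_param[OF assms, of id] smooth_on_id[OF assms]
  by (auto simp: Hausdorff_space_subtopology second_countable_subtopology second_countable_euclidean
      subtopology_subtopology)

lemma dmap_open:
  assumes "open S" "p \<in> S" "(f has_derivative D) (at p)"
  shows "dmap (S, id) f p = D"
proof -
  have "((f \<circ> param (S, id)) has_derivative D) (at p)"
    using has_derivative_transform_within_open[OF assms(3,1,2)] by (simp add: param_id)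
  then show ?thesis
    using frechet_derivative_at by (fastforce simp: dmap_def)
qed

lemma matrix_inv_eq:
  fixes M :: "real ^ 'n ^ 'n"
  assumes "M ** M' = mat 1"
  shows "matrix_inv M = M'"
proof -
  have "M' ** M = mat 1" by (rule matrix_left_right_inverse[THEN iffD1, OF assms])
  then have "\<exists>M'. M ** M' = mat 1 \<and> M' ** M = mat 1" using assms by blast
  then have "M ** matrix_inv M = mat 1 \<and> matrix_inv M ** M = mat 1"
    unfolding matrix_inv_def by (rule someI_ex)
  then have "matrix_inv M ** M = mat 1" ..
  then have "matrix_inv M ** (M ** M') = M'"
    by (simp add: matrix_mul_assoc)
  then show ?thesis using assms by simp
qed

text \<open>The chart domain is the whole space, so the chart formula prescribes the measure of
  every measurable set; this gives uniqueness. For existence, the Borel sets of S are the traces on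
  S of the Borel sets of the ambient space.\<close>

lemma riemannian_volume_open:
  assumes S: "open S" and cont: "continuous_on S (\<lambda>x. det (gram (S, id) F x))"
  shows "riemannian_volume (top_of_set S) {(S, id)} F =
    density (restrict_space lborel S) (\<lambda>x. ennreal (sqrt (det (gram (S, id) F x))))"
proof -
  define w where "w x = ennreal (sqrt (det (gram (S, id) F x)))" for x
  let ?\<mu> = "density (restrict_space lborel S) w"
  have meas: "w \<in> borel_measurable (restrict_space lborel S)"
  proof -
    have "(\<lambda>x. sqrt (det (gram (S, id) F x))) \<in> borel_measurable (restrict_space borel S)"
      by (intro borel_measurable_continuous_on_restrict continuous_intros cont)
    moreover have "sets (restrict_space lborel S) = sets (restrict_space borel S)"
      by (simp add: sets_restrict_space)
    ultimately show ?thesis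
      unfolding w_def by (subst measurable_cong_sets[OF _ refl])
        (auto intro: measurable_compose[OF _ measurable_ennreal])
  qed
  have "sets ?\<mu> = (\<inter>) S ` sigma_sets UNIV {U. open U}"
    by (simp add: sets_restrict_space borel_def)
  also have "\<dots> = sigma_sets S ((\<inter>) S ` {U. open U})"
    using S by (intro sigma_sets_Int) auto
  also have "(\<inter>) S ` {U. open U} = {U. openin (top_of_set S) U}"
    by (auto simp: openin_open)
  finally have sets: "sets ?\<mu> = sigma_sets S {U. openin (top_of_set S) U}" .
  have sub: "B \<subseteq> S" if "B \<in> sigma_sets S {U. openin (top_of_set S) U}" for B
    using sigma_sets_into_sp[OF _ that] openin_subset by fastforce
  have formula: "emeasure ?\<mu> B = (\<integral>\<^sup>+x\<in>id ` B. ennreal (sqrt (det (gram (S, id) F (param (S, id) x)))) \<partial>lborel)"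
    if B: "B \<in> sets ?\<mu>" for B
  proof -
    have "emeasure ?\<mu> B = (\<integral>\<^sup>+x. w x * indicator B x \<partial>restrict_space lborel S)"
      using B by (intro emeasure_density meas) simp
    also have "\<dots> = (\<integral>\<^sup>+x. w x * indicator B x * indicator S x \<partial>lborel)"
      using S by (intro nn_integral_restrict_space) simp
    also have "\<dots> = (\<integral>\<^sup>+x\<in>id ` B. ennreal (sqrt (det (gram (S, id) F (param (S, id) x)))) \<partial>lborel)"
      using sub B unfolding sets by (intro nn_integral_cong) (auto simp: indicator_def w_def param_id)
    finally show ?thesis .
  qed
  have "riemannian_volume (top_of_set S) {(S, id)} F = ?\<mu>"
    unfolding riemannian_volume_def
  proof (rule the_equality)
    show "is_riemannian_volume (top_of_set S) {(S, id)} F ?\<mu>"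
      using formula sets by (simp add: is_riemannian_volume_def space_restrict_space)
  next
    fix \<mu> assume \<mu>: "is_riemannian_volume (top_of_set S) {(S, id)} F \<mu>"
    show "\<mu> = ?\<mu>"
    proof (rule measure_eqI)
      show eq: "sets \<mu> = sets ?\<mu>" using \<mu> sets by (simp add: is_riemannian_volume_def)
      fix B assume "B \<in> sets \<mu>"
      then show "emeasure \<mu> B = emeasure ?\<mu> B"
        using \<mu> formula[of B] eq sub[of B] sets by (simp add: is_riemannian_volume_def)
    qed
  qed
  then show ?thesis by (simp add: w_def[abs_def])
qed

section \<open>Rank-one perturbations of diagonal matrices\<close>

text \<open>The multiples of v in the rows of T are removed by subtracting multiples of row k, which
  is v itself. For the diagonal matrix that remains, Cramer's rule applies with v as the combination
  of its rows with coefficients v_i / d_i.\<close>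

lemma det_diag_row_replaced:
  fixes d :: "'n::finite \<Rightarrow> real" and v :: "real ^ 'n"
  assumes "\<And>i. d i \<noteq> 0" "k \<notin> T"
  shows "det (\<chi> i. if i = k then v else if i \<in> T then d i *s axis i 1 + u i *s v else d i *s axis i 1)
    = v $ k / d k * (\<Prod>i\<in>UNIV. d i)"
proof -
  have "finite T" by simp
  then show ?thesis using assms(2)
  proof (induction T rule: finite_induct)
    case empty
    define M :: "real ^ 'n ^ 'n" where "M = (\<chi> i. d i *s axis i 1)"
    define x :: "real ^ 'n" where "x = (\<chi> i. v $ i / d i)"
    have "row i M = d i *s axis i 1" for i by (simp add: M_def row_def vec_eq_iff)
    then have "(\<Sum>i\<in>UNIV. x $ i *s row i M) = (\<Sum>i\<in>UNIV. v $ i *s axis i 1)"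
      using assms(1) by (simp add: x_def)
    then have sum: "(\<Sum>i\<in>UNIV. x $ i *s row i M) = v" by (simp add: basis_expansion)
    have "det M = (\<Prod>i\<in>UNIV. d i)"
      by (subst det_diagonal) (auto simp: M_def axis_def)
    moreover have "(\<chi> i. if i = k then (\<Sum>i\<in>UNIV. x $ i *s row i M) else row i M) =
        (\<chi> i. if i = k then v else if i \<in> {} then d i *s axis i 1 + u i *s v else d i *s axis i 1)"
      unfolding sum by (auto simp: vec_eq_iff M_def row_def)
    ultimately show ?case
      using cramer_lemma_transpose[of k x M] by (simp add: x_def)
  next
    case (insert j T)
    let ?M = "\<lambda>T. (\<chi> i. if i = k then v else if i \<in> T then d i *s axis i 1 + u i *s v else d i *s axis i 1) :: real ^ 'n ^ 'n"
    have "j \<noteq> k" using insert.prems by auto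
    have "?M (insert j T) = (\<chi> i. if i = j then row j (?M T) + u j *s row k (?M T) else row i (?M T))"
      using insert.hyps(2) \<open>j \<noteq> k\<close> by (auto simp: vec_eq_iff row_def)
    then have "det (?M (insert j T)) = det (?M T)"
      by (simp only: det_row_operation[OF \<open>j \<noteq> k\<close>])
    then show ?case using insert by simp
  qed
qed

text \<open>The matrix determinant lemma. The rank-one term is added row by row: linearity in the
  new row k splits off u_k times a determinant in which that row is v, which is the preceding
  lemma.\<close>

lemma det_diag_plus_rank_one:
  fixes d u :: "'n::finite \<Rightarrow> real" and v :: "real ^ 'n"
  assumes "\<And>i. d i \<noteq> 0"
  shows "det (\<chi> i j. (if i = j then d i else 0) + u i * v $ j) =
    (\<Prod>i\<in>UNIV. d i) * (1 + (\<Sum>i\<in>UNIV. u i * v $ i / d i))"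
proof -
  let ?M = "\<lambda>S. (\<chi> i. if i \<in> S then d i *s axis i 1 + u i *s v else d i *s axis i 1) :: real ^ 'n ^ 'n"
  have all: "det (?M S) = (\<Prod>i\<in>UNIV. d i) * (1 + (\<Sum>i\<in>S. u i * v $ i / d i))" if "finite S" for S
    using that
  proof (induction S rule: finite_induct)
    case empty
    show ?case by (subst det_diagonal) (auto simp: axis_def)
  next
    case (insert k S)
    have "?M (insert k S) = (\<chi> i. if i = k then d i *s axis i 1 + u i *s v else ?M S $ i)"
      by (auto simp: vec_eq_iff)
    then have "det (?M (insert k S)) = det (\<chi> i. if i = k then d i *s axis i 1 else ?M S $ i)
        + det (\<chi> i. if i = k then u i *s v else ?M S $ i)"
      by (simp only: det_row_add)
    also have "(\<chi> i. if i = k then d i *s axis i 1 else ?M S $ i) = ?M S"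
      using insert.hyps(2) by (auto simp: vec_eq_iff)
    also have "(\<chi> i. if i = k then u i *s v else ?M S $ i) = (\<chi> i. if i = k then u k *s v else ?M S $ i)"
      by (auto simp: vec_eq_iff)
    also have "det \<dots> = u k * det (\<chi> i. if i = k then v else ?M S $ i)"
      by (rule det_row_mul)
    also have "(\<chi> i. if i = k then v else ?M S $ i) =
        (\<chi> i. if i = k then v else if i \<in> S then d i *s axis i 1 + u i *s v else d i *s axis i 1)"
      by (auto simp: vec_eq_iff)
    finally show ?case
      using insert det_diag_row_replaced[OF assms insert.hyps(2)] by (simp add: algebra_simps)
  qed
  have eq: "(\<chi> i j. (if i = j then d i else 0) + u i * v $ j) = ?M UNIV"
    by (auto simp: vec_eq_iff axis_def)
  show ?thesis unfolding eq using all[of UNIV] by simp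
qed

section \<open>Integrals of derivatives\<close>

lemma has_derivative_zero_outside:
  fixes \<phi> :: "'a::real_normed_vector \<Rightarrow> real"
  assumes "(\<phi> has_derivative D) (at x)" "closed K" "\<And>y. y \<notin> K \<Longrightarrow> \<phi> y = 0" "x \<notin> K"
  shows "D = (\<lambda>v. 0)"
proof -
  have "((\<lambda>y. 0) has_derivative D) (at x)"
    by (rule has_derivative_transform_within_open[OF assms(1), of "- K"]) (use assms in auto)
  then show ?thesis
    using has_derivative_unique[OF _ has_derivative_const] by blast
qed

text \<open>Difference quotients in direction v have integral 0 by translation invariance of
  Lebesgue measure, and they converge to the derivative. Dominated convergence carries the value 0
  to the limit.\<close>

lemma integral_derivative_compact_support:
  fixes \<phi> :: "'a::euclidean_space \<Rightarrow> real"
  assumes der: "\<And>x. (\<phi> has_derivative D x) (at x)"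
    and cont: "continuous_on UNIV (\<lambda>x. D x v)"
    and K: "compact K" "\<And>x. x \<notin> K \<Longrightarrow> \<phi> x = 0"
  shows "integrable lborel (\<lambda>x. D x v)" and "(\<integral>x. D x v \<partial>lborel) = 0"
proof -
  have D0: "D x v = 0" if "x \<notin> K" for x
    using has_derivative_zero_outside[OF der compact_imp_closed[OF K(1)] K(2) that] by simp
  have restr: "integrable lborel g" if "continuous_on UNIV g" "\<And>x. x \<notin> K \<Longrightarrow> g x = 0" for g :: "'a \<Rightarrow> real"
  proof -
    have "integrable lborel (\<lambda>x. indicator K x *\<^sub>R g x)"
      using borel_integrable_compact[OF K(1)] that(1) continuous_on_subset by blast
    moreover have "(\<lambda>x. indicator K x *\<^sub>R g x) = g" using that(2) by (auto simp: fun_eq_iff indicator_def)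
    ultimately show ?thesis by (simp only:)
  qed
  show "integrable lborel (\<lambda>x. D x v)" by (rule restr[OF cont D0])
  have "continuous_on UNIV \<phi>"
    by (auto intro!: continuous_at_imp_continuous_on has_derivative_continuous[OF der])
  then have int\<phi>: "integrable lborel \<phi>" using restr K(2) by blast
  obtain L where L: "\<And>x. \<bar>D x v\<bar> \<le> L" 
  proof -
    have "bounded ((\<lambda>x. D x v) ` K)"
      using compact_continuous_image[OF continuous_on_subset[OF cont] K(1)] compact_imp_bounded by blast
    then obtain B where "\<And>x. x \<in> K \<Longrightarrow> \<bar>D x v\<bar> \<le> B" by (auto simp: bounded_iff)
    then have "\<bar>D x v\<bar> \<le> max B 0" for x
      using D0[of x] by (cases "x \<in> K") (auto simp: max.coboundedI1)
    then show ?thesis using that by blast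
  qed
  define h where "h n = 1 / real (Suc n)" for n
  have h: "0 < h n" "h n \<le> 1" for n by (simp_all add: h_def)
  define q where "q n x = (\<phi> (x + h n *\<^sub>R v) - \<phi> x) / h n" for n x
  \<comment> \<open>All step sizes \<open>h n\<close> are at most 1, so sweeping K along -v for
    times in [0, 1] gives one compact set outside which every difference quotient vanishes. On it
    the mean value theorem bounds the quotients by L.\<close>
  define K' where "K' = (\<lambda>(x, t). x - t *\<^sub>R v) ` (K \<times> {0..1::real})"
  have "compact K'"
    unfolding K'_def by (intro compact_continuous_image compact_Times K(1))
      (auto intro!: continuous_intros simp: split_beta)
  have q_bound: "\<bar>q n x\<bar> \<le> L * indicator K' x" for n x
  proof (cases "x \<in> K'")
    case True
    have "((\<lambda>t. \<phi> (x + t *\<^sub>R v)) has_derivative (\<lambda>s. D (x + t *\<^sub>R v) (s *\<^sub>R v))) (at t)" for t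
      by (rule has_derivative_compose[OF _ der]) (auto intro!: derivative_eq_intros)
    then have "((\<lambda>t. \<phi> (x + t *\<^sub>R v)) has_real_derivative D (x + t *\<^sub>R v) v) (at t)" for t
      using linear_cmul[OF has_derivative_linear[OF der]]
      by (simp add: has_field_derivative_def mult.commute[of _ "D _ _"])
    then obtain z where "\<phi> (x + h n *\<^sub>R v) - \<phi> (x + 0 *\<^sub>R v) = (h n - 0) * D (x + z *\<^sub>R v) v"
      using MVT2[OF h(1)[of n], of "\<lambda>t. \<phi> (x + t *\<^sub>R v)" "\<lambda>t. D (x + t *\<^sub>R v) v"] by blast
    then have "q n x = D (x + z *\<^sub>R v) v" using h(1)[of n] by (simp add: q_def)
    then show ?thesis using L True by simp
  next
    case False
    have "x \<notin> K" using False unfolding K'_def by force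
    moreover have "x + h n *\<^sub>R v \<notin> K"
    proof
      assume "x + h n *\<^sub>R v \<in> K"
      then have "x + h n *\<^sub>R v - h n *\<^sub>R v \<in> K'"
        unfolding K'_def using h[of n] by (intro image_eqI[of _ _ "(x + h n *\<^sub>R v, h n)"]) auto
      then show False using False by simp
    qed
    ultimately show ?thesis using K(2) False by (simp add: q_def)
  qed
  have q_lim: "(\<lambda>n. q n x) \<longlonglongrightarrow> D x v" for x
  proof -
    have "((\<lambda>t. \<phi> (x + t *\<^sub>R v)) has_derivative (\<lambda>s. D (x + 0 *\<^sub>R v) (s *\<^sub>R v))) (at 0)"
      by (rule has_derivative_compose[OF _ der]) (auto intro!: derivative_eq_intros)
    then have "((\<lambda>t. \<phi> (x + t *\<^sub>R v)) has_real_derivative D x v) (at 0)"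
      using linear_cmul[OF has_derivative_linear[OF der]]
      by (simp add: has_field_derivative_def mult.commute[of _ "D _ _"])
    then have "((\<lambda>s. (\<phi> (x + s *\<^sub>R v) - \<phi> x) / s) \<longlongrightarrow> D x v) (at 0)"
      by (simp add: DERIV_def)
    moreover have "filterlim h (at 0) sequentially"
      unfolding filterlim_at using h(1) LIMSEQ_inverse_real_of_nat
      by (auto simp: h_def[abs_def] inverse_eq_divide intro!: always_eventually less_imp_neq[symmetric])
    ultimately show ?thesis
      unfolding q_def using filterlim_compose by blast
  qed
  have trans: "integrable lborel (\<lambda>x. \<phi> (x + c))" "(\<integral>x. \<phi> (x + c) \<partial>lborel) = (\<integral>x. \<phi> x \<partial>lborel)" for c
  proof -
    have m: "\<phi> \<in> borel_measurable borel" using int\<phi> by auto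
    have "integrable (distr lborel borel ((+) c)) \<phi>" using int\<phi> by (simp add: lborel_distr_plus)
    then show "integrable lborel (\<lambda>x. \<phi> (x + c))"
      using integrable_distr_eq[of "(+) c" lborel borel \<phi>] m by (simp add: add.commute)
    have "(\<integral>x. \<phi> x \<partial>distr lborel borel ((+) c)) = (\<integral>x. \<phi> (x + c) \<partial>lborel)"
      using integral_distr[of "(+) c" lborel borel \<phi>] m by (simp add: add.commute)
    then show "(\<integral>x. \<phi> (x + c) \<partial>lborel) = (\<integral>x. \<phi> x \<partial>lborel)" by (simp add: lborel_distr_plus)
  qed
  have q_int: "integrable lborel (q n)" "(\<integral>x. q n x \<partial>lborel) = 0" for n
    unfolding q_def using trans int\<phi> by simp_all
  have "(\<lambda>n. \<integral>x. q n x \<partial>lborel) \<longlonglongrightarrow> (\<integral>x. D x v \<partial>lborel)"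
  proof (rule integral_dominated_convergence[where w = "\<lambda>x. L * indicator K' x"])
    show "(\<lambda>x. D x v) \<in> borel_measurable lborel" using cont borel_measurable_continuous_onI by auto
    show "q n \<in> borel_measurable lborel" for n using q_int(1) by auto
    have "integrable lborel (indicator K' :: 'a \<Rightarrow> real)"
      using \<open>compact K'\<close> emeasure_bounded_finite[OF compact_imp_bounded[of K']]
      by (intro integrable_real_indicator) (auto simp: borel_compact)
    then show "integrable lborel (\<lambda>x. L * indicator K' x)" by simp
  qed (use q_lim q_bound in auto)
  then show "(\<integral>x. D x v \<partial>lborel) = 0"
    unfolding q_int(2) using LIMSEQ_unique tendsto_const by blast
qed

section \<open>The tube and its metric\<close>

text \<open>The coordinates indexed by \<open>I\<close> form y and the others form z; in the
  application there are four and two of them. \<open>E\<close> places the chart isometrically in the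
  spatial part of Minkowski space, and \<open>e\<close> is the additional unit direction required by
  the hyperboloid. Selecting coordinates by a set keeps the chart in a single vector type rather
  than in a product.\<close>

locale hyperbolic_tube =
  fixes I :: "'n::finite set" and E :: "real ^ 'n \<Rightarrow> 'e::euclidean_space" and e :: 'e
  assumes linear_E: "linear E" and inner_E: "E x \<bullet> E y = x \<bullet> y"
    and inner_e: "e \<bullet> e = 1" and inner_E_e: "E x \<bullet> e = 0"
begin

definition P :: "real ^ 'n \<Rightarrow> real ^ 'n" where
  "P x = (\<chi> i. if i \<in> I then x $ i else 0)"

definition Omega :: "(real ^ 'n) set" ("\<Omega>") where
  "\<Omega> = {x. P x \<noteq> 0}"

definition r :: "real ^ 'n \<Rightarrow> real" where
  "r x = inverse (norm (P x))"

definition mk :: "real \<Rightarrow> real \<Rightarrow> real ^ 'n \<Rightarrow> real \<times> 'e" where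
  "mk \<alpha> \<beta> z = (\<alpha>, \<beta> *\<^sub>R e + E z)"

text \<open>The orthogonal projection \<open>P\<close> splits \<open>x = y + z\<close> with \<open>y = P x\<close>; then \<open>(\<bar>y\<bar>, z)\<close> are half-space
  coordinates on hyperbolic 3-space and \<open>y / \<bar>y\<bar>\<close> is the spherical coordinate. The map
  \<open>G a b = r W a b\<close> is \<open>a X + b Y\<close>, where \<open>X\<close> is the point of the hyperboloid with these half-space
  coordinates and \<open>Y\<close> the point of the unit sphere.\<close>

definition W :: "real \<Rightarrow> real \<Rightarrow> real ^ 'n \<Rightarrow> real \<times> 'e" where
  "W a b x = mk (a / 2 * (1 + x \<bullet> x)) (a / 2 * (1 - x \<bullet> x)) (a *\<^sub>R x + (b - a) *\<^sub>R P x)"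

definition dW :: "real \<Rightarrow> real \<Rightarrow> real ^ 'n \<Rightarrow> real ^ 'n \<Rightarrow> real \<times> 'e" where
  "dW a b x v = mk (a * (x \<bullet> v)) (- (a * (x \<bullet> v))) (a *\<^sub>R v + (b - a) *\<^sub>R P v)"

definition G :: "real \<Rightarrow> real \<Rightarrow> real ^ 'n \<Rightarrow> real \<times> 'e" where
  "G a b x = r x *\<^sub>R W a b x"

definition dG :: "real \<Rightarrow> real \<Rightarrow> real ^ 'n \<Rightarrow> real ^ 'n \<Rightarrow> real \<times> 'e" where
  "dG a b x v = r x *\<^sub>R dW a b x v - ((r x)^3 * (P x \<bullet> v)) *\<^sub>R W a b x"

lemma lorentz_mk: "lorentz (mk \<alpha> \<beta> z) (mk \<alpha>' \<beta>' z') = \<beta> * \<beta>' + z \<bullet> z' - \<alpha> * \<alpha>'"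
  using inner_E_e[of z] inner_E_e[of z']
  by (simp add: mk_def lorentz_def inner_add_left inner_add_right inner_E inner_e inner_commute)

lemma linear_P: "linear P"
  by (rule linearI) (auto simp: P_def vec_eq_iff)

lemma bounded_linear_P: "bounded_linear P"
  using linear_P linear_conv_bounded_linear by blast

lemma P_P [simp]: "P (P x) = P x"
  by (simp add: P_def vec_eq_iff)

text \<open>An orthogonal projection is self-adjoint. As a rewrite rule this moves \<open>P\<close>
  to the left factor, so |y|^2 has the normal form \<open>P x \<bullet> x\<close>
  throughout.\<close>

lemma inner_P [simp]: "x \<bullet> P y = P x \<bullet> y"
  by (simp add: P_def inner_vec_def if_distrib cong: if_cong) (rule sum.cong; simp)

lemma inner_P_commute: "P v \<bullet> x = P x \<bullet> v"
  by (metis inner_P inner_commute)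

lemma P_nth: "P x $ i = (if i \<in> I then x $ i else 0)"
  by (simp add: P_def)

lemma norm_P_le: "norm (P x) \<le> norm x"
  unfolding norm_vec_def L2_set_def
  by (intro real_sqrt_le_mono sum_mono) (auto simp: P_nth)

lemma open_Omega: "open \<Omega>"
proof -
  have "\<Omega> = P -` (- {0})" by (auto simp: Omega_def)
  then show ?thesis
    using continuous_open_vimage[of "- {0}" P] linear_continuous_at[OF bounded_linear_P] by auto
qed

lemma r_pos: "x \<in> \<Omega> \<Longrightarrow> 0 < r x"
  by (simp add: Omega_def r_def)

lemma r_sq: "x \<in> \<Omega> \<Longrightarrow> (r x)\<^sup>2 * (P x \<bullet> x) = 1"
proof -
  assume "x \<in> \<Omega>"
  then have "P x \<bullet> P x \<noteq> 0" by (simp add: Omega_def del: inner_P)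
  moreover have "(r x)\<^sup>2 = inverse (P x \<bullet> P x)"
    by (simp add: r_def power_inverse power2_norm_eq_inner del: inner_P)
  ultimately show ?thesis by simp
qed

lemma has_derivative_r:
  assumes "x \<in> \<Omega>"
  shows "(r has_derivative (\<lambda>v. - ((r x)^3 * (P x \<bullet> v)))) (at x)"
proof -
  have nz: "P x \<noteq> 0" using assms by (simp add: Omega_def)
  have "((\<lambda>x. norm (P x)) has_derivative (\<lambda>v. P v \<bullet> sgn (P x))) (at x)"
    using has_derivative_compose[OF bounded_linear_imp_has_derivative[OF bounded_linear_P]
        has_derivative_norm[OF nz]] .
  from Deriv.has_derivative_inverse[OF _ this] nz
  have "(r has_derivative (\<lambda>v. - (inverse (norm (P x)) * (P v \<bullet> sgn (P x)) * inverse (norm (P x))))) (at x)"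
    unfolding r_def[abs_def] by auto
  moreover have "inverse (norm (P x)) * (P v \<bullet> sgn (P x)) * inverse (norm (P x)) = (r x)^3 * (P x \<bullet> v)" for v
    by (simp add: sgn_div_norm r_def power3_eq_cube inner_P_commute[of v x])
  ultimately show ?thesis by simp
qed

lemma has_derivative_G:
  assumes "x \<in> \<Omega>"
  shows "(G a b has_derivative dG a b x) (at x)"
proof -
  have L: "bounded_linear E" using linear_E linear_conv_bounded_linear by blast
  have "(W a b has_derivative dW a b x) (at x)"
    unfolding W_def[abs_def] dW_def[abs_def] mk_def
    by (auto intro!: derivative_eq_intros bounded_linear.has_derivative[OF L]
        bounded_linear.has_derivative[OF bounded_linear_P] simp: inner_commute algebra_simps)
  from has_derivative_scaleR[OF has_derivative_r[OF assms] this]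
  show ?thesis unfolding G_def[abs_def] dG_def[abs_def] by (simp add: fun_eq_iff)
qed

text \<open>The hyperbolic metric \<open>(d\<rho>\<^sup>2 + \<bar>dz\<bar>\<^sup>2) / \<rho>\<^sup>2\<close> and the metric of the unit sphere.\<close>

definition horiz :: "real ^ 'n \<Rightarrow> real ^ 'n \<Rightarrow> real ^ 'n \<Rightarrow> real" where
  "horiz x v w = (r x)\<^sup>2 * (v \<bullet> w - P v \<bullet> w) + (r x)^4 * (P x \<bullet> v) * (P x \<bullet> w)"

definition vert :: "real ^ 'n \<Rightarrow> real ^ 'n \<Rightarrow> real ^ 'n \<Rightarrow> real" where
  "vert x v w = (r x)\<^sup>2 * (P v \<bullet> w) - (r x)^4 * (P x \<bullet> v) * (P x \<bullet> w)"

section \<open>Lorentz products of the lifts and of their differentials\<close>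

lemma inner_P_combination:
  "(a *\<^sub>R x + (b - a) *\<^sub>R P x) \<bullet> (c *\<^sub>R y + (d - c) *\<^sub>R P y) =
    a * c * (x \<bullet> y) + (b * d - a * c) * (P x \<bullet> y)"
proof -
  have "P (a *\<^sub>R x + (b - a) *\<^sub>R P x) = b *\<^sub>R P x"
    by (simp add: P_def vec_eq_iff algebra_simps)
  then show ?thesis
    by (simp add: inner_add_left inner_add_right) (simp add: algebra_simps)
qed

text \<open>The time component and the component along \<open>e\<close> contribute - a c |x|^2,
  which cancels the Euclidean part. In particular \<open>W a a\<close> takes values in the light
  cone.\<close>

lemma lorentz_W_W: "lorentz (W a b x) (W c d x) = (b * d - a * c) * (P x \<bullet> x)"
  unfolding W_def lorentz_mk inner_P_combination by (simp add: field_simps)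

lemma lorentz_dW_W: "lorentz (dW a b x v) (W c d x) = (b * d - a * c) * (P x \<bullet> v)"
  unfolding W_def dW_def lorentz_mk inner_P_combination inner_P_commute[of v x] inner_commute[of v x]
  by (simp add: field_simps)

lemma lorentz_W_dW: "lorentz (W a b x) (dW c d x v) = (b * d - a * c) * (P x \<bullet> v)"
  using lorentz_dW_W[of c d x v a b] by (simp add: lorentz_commute mult.commute)

lemma lorentz_dW_dW:
  "lorentz (dW a b x v) (dW c d x w) = a * c * (v \<bullet> w) + (b * d - a * c) * (P v \<bullet> w)"
  unfolding dW_def lorentz_mk inner_P_combination by simp

lemma lorentz_G_G:
  assumes "x \<in> \<Omega>"
  shows "lorentz (G a b x) (G c d x) = b * d - a * c"
proof -
  have "lorentz (G a b x) (G c d x) = (b * d - a * c) * ((r x)\<^sup>2 * (P x \<bullet> x))"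
    by (simp add: G_def lorentz_simps lorentz_W_W power2_eq_square)
  then show ?thesis by (simp add: r_sq[OF assms])
qed

lemma lorentz_dG_G:
  assumes "x \<in> \<Omega>"
  shows "lorentz (dG a b x v) (G c d x) = 0"
proof -
  have "lorentz (dG a b x v) (G c d x) =
      (b * d - a * c) * (P x \<bullet> v) * (r x)\<^sup>2 * (1 - (r x)\<^sup>2 * (P x \<bullet> x))"
    unfolding G_def dG_def lorentz_simps lorentz_W_W lorentz_dW_W by algebra
  then show ?thesis by (simp add: r_sq[OF assms])
qed

text \<open>The leftover terms from differentiating the factor r combine into a multiple of r^2
  |y|^2 - 1 = 0. What survives is the product metric with weight a c on H^3 and b d on S^3.\<close>

lemma lorentz_dG_dG:
  assumes "x \<in> \<Omega>"
  shows "lorentz (dG a b x v) (dG c d x w) = a * c * horiz x v w + b * d * vert x v w"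
proof -
  have "lorentz (dG a b x v) (dG c d x w) = a * c * horiz x v w + b * d * vert x v w
      + (b * d - a * c) * (P x \<bullet> v) * (P x \<bullet> w) * (r x)^4 * ((r x)\<^sup>2 * (P x \<bullet> x) - 1)"
    unfolding horiz_def vert_def dG_def lorentz_simps lorentz_W_W lorentz_dW_W lorentz_W_dW lorentz_dW_dW
    by (simp add: algebra_simps power2_eq_square power3_eq_cube power4_eq_xxxx)
  then show ?thesis by (simp add: r_sq[OF assms])
qed

text \<open>The derivative - r^3 (y . v) is a product of copies of r and a linear function, so
  regularity of r of order k gives order k + 1.\<close>

lemma Ck_on_r: "Ck_on k \<Omega> r"
proof (induction k)
  case 0
  show ?case
    by (auto intro!: continuous_at_imp_continuous_on has_derivative_continuous[OF has_derivative_r])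
next
  case (Suc k)
  show ?case
  proof (rule Ck_on_SucI[OF open_Omega has_derivative_r])
    fix v
    have "Ck_on k \<Omega> (\<lambda>x. (r x * (r x * r x)) * (P x \<bullet> (- v)))"
      by (intro Ck_on_bilinear[OF bounded_bilinear_mult] open_Omega Suc
          Ck_on_bounded_linear bounded_linear_compose[OF bounded_linear_inner_left bounded_linear_P])
    then show "Ck_on k \<Omega> (\<lambda>x. - ((r x)^3 * (P x \<bullet> v)))"
      by (simp add: power3_eq_cube mult.assoc)
  qed
qed

text \<open>Apart from the factor r, the formula is a constant vector plus |x|^2 times a second
  constant vector plus a linear map.\<close>

lemma smooth_on_G: "smooth_on \<Omega> (G a b)"
  unfolding smooth_on_def
proof
  fix k
  have "linear (\<lambda>x. mk 0 0 (a *\<^sub>R x + (b - a) *\<^sub>R P x))"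
    by (rule linearI) (simp_all add: mk_def linear_add[OF linear_E] linear_cmul[OF linear_E]
        linear_diff[OF linear_E] linear_add[OF linear_P] linear_cmul[OF linear_P] algebra_simps)
  then have 1: "bounded_linear (\<lambda>x. mk 0 0 (a *\<^sub>R x + (b - a) *\<^sub>R P x))"
    using linear_conv_bounded_linear by blast
  have "Ck_on k \<Omega> (\<lambda>x. r x *\<^sub>R ((mk (a / 2) (a / 2) 0 + (x \<bullet> x) *\<^sub>R mk (a / 2) (- (a / 2)) 0)
       + mk 0 0 (a *\<^sub>R x + (b - a) *\<^sub>R P x)))"
    by (intro Ck_on_bilinear[OF bounded_bilinear_scaleR] Ck_on_bilinear[OF bounded_bilinear_inner]
        Ck_on_add Ck_on_const Ck_on_bounded_linear open_Omega Ck_on_r 1 bounded_linear_ident)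
  moreover have "r x *\<^sub>R ((mk (a / 2) (a / 2) 0 + (x \<bullet> x) *\<^sub>R mk (a / 2) (- (a / 2)) 0)
       + mk 0 0 (a *\<^sub>R x + (b - a) *\<^sub>R P x)) = G a b x" for x
    by (simp add: G_def W_def mk_def linear_0[OF linear_E] scaleR_left_diff_distrib right_diff_distrib
        distrib_left diff_divide_distrib)
  ultimately show "Ck_on k \<Omega> (G a b)" by simp
qed

abbreviation atlas :: "(real ^ 'n, 'n) chart set" where
  "atlas \<equiv> {(\<Omega>, id)}"

text \<open>The distance \<open>s\<close> from the core has \<open>cosh s = 2\<close> and \<open>sinh s = \<surd>3\<close>; the normal is
  \<open>\<partial>F/\<partial>s\<close>.\<close>

abbreviation F :: "real ^ 'n \<Rightarrow> real \<times> 'e" where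
  "F \<equiv> G 2 (sqrt 3)"

abbreviation N :: "real ^ 'n \<Rightarrow> real \<times> 'e" where
  "N \<equiv> G (sqrt 3) 2"

section \<open>Induced metric and second fundamental form\<close>

lemma dmap_G: "x \<in> \<Omega> \<Longrightarrow> dmap (\<Omega>, id) (G a b) x = dG a b x"
  by (rule dmap_open[OF open_Omega _ has_derivative_G])

lemma ind_metric_F:
  assumes "x \<in> \<Omega>"
  shows "ind_metric (\<Omega>, id) F x v w =
    (r x)\<^sup>2 * (4 * (v \<bullet> w) - P v \<bullet> w) + (r x)^4 * (P x \<bullet> v) * (P x \<bullet> w)"
  unfolding ind_metric_def dmap_G[OF assms] lorentz_dG_dG[OF assms] horiz_def vert_def
  by (simp add: algebra_simps)

text \<open>The differential of \<open>N\<close> is already tangent to hyperbolic space. The weights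
  of \<open>N\<close> and \<open>F\<close> multiply to 2 sqrt 3 on both factors, so the form is a
  multiple of \<open>horiz + vert\<close>, in which all terms with \<open>P\<close> cancel.\<close>

lemma second_form_F:
  assumes "x \<in> \<Omega>"
  shows "second_form (\<Omega>, id) F N x v w = 2 * sqrt 3 * (r x)\<^sup>2 * (v \<bullet> w)"
proof -
  have "tangential (F x) (dG (sqrt 3) 2 x v) = dG (sqrt 3) 2 x v"
    by (simp add: tangential_def lorentz_dG_G[OF assms])
  then have "second_form (\<Omega>, id) F N x v w = 2 * sqrt 3 * (horiz x v w + vert x v w)"
    unfolding second_form_def dmap_G[OF assms] by (simp add: lorentz_dG_dG[OF assms] algebra_simps)
  then show ?thesis by (simp add: horiz_def vert_def algebra_simps)
qed

text \<open>Relative to r^2 times the Euclidean product, the metric has eigenvalue 3 on the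
  directions in the range of \<open>P\<close> orthogonal to \<open>P x\<close>, and 4 on the
  complementary ones. The comparison yields injectivity of the differential and both length
  estimates for completeness.\<close>

lemma ind_metric_bounds:
  assumes "x \<in> \<Omega>"
  shows "3 * ((r x)\<^sup>2 * (v \<bullet> v)) \<le> ind_metric (\<Omega>, id) F x v v"
    and "ind_metric (\<Omega>, id) F x v v \<le> 4 * ((r x)\<^sup>2 * (v \<bullet> v))"
proof -
  have 1: "P v \<bullet> v \<le> v \<bullet> v"
    using norm_P_le[of v] inner_P[of "P v" v] by (simp add: norm_le)
  have "(P x \<bullet> v)\<^sup>2 \<le> (P x \<bullet> P x) * (P v \<bullet> P v)"
    using Cauchy_Schwarz_ineq[of "P x" "P v"] by simp
  then have 2: "(P x \<bullet> v)\<^sup>2 \<le> (P x \<bullet> x) * (P v \<bullet> v)" by simp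
  have "(r x)^4 * (P x \<bullet> v)\<^sup>2 \<le> (r x)^4 * ((P x \<bullet> x) * (P v \<bullet> v))"
    by (intro mult_left_mono 2) simp
  also have "\<dots> = ((r x)\<^sup>2 * (P x \<bullet> x)) * ((r x)\<^sup>2 * (P v \<bullet> v))"
    by (simp add: power2_eq_square power4_eq_xxxx)
  finally have 3: "(r x)^4 * (P x \<bullet> v)\<^sup>2 \<le> (r x)\<^sup>2 * (P v \<bullet> v)"
    by (simp add: r_sq[OF assms])
  have 4: "(r x)\<^sup>2 * (P v \<bullet> v) \<le> (r x)\<^sup>2 * (v \<bullet> v)"
    by (intro mult_left_mono 1) simp
  have 5: "ind_metric (\<Omega>, id) F x v v =
      4 * ((r x)\<^sup>2 * (v \<bullet> v)) - (r x)\<^sup>2 * (P v \<bullet> v) + (r x)^4 * (P x \<bullet> v)\<^sup>2"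
    by (simp add: ind_metric_F[OF assms] power2_eq_square algebra_simps)
  show "3 * ((r x)\<^sup>2 * (v \<bullet> v)) \<le> ind_metric (\<Omega>, id) F x v v"
    unfolding 5 using 4 zero_le_even_power[of 4 "r x"] zero_le_power2[of "P x \<bullet> v"]
    by (smt (verit) mult_nonneg_nonneg even_numeral)
  show "ind_metric (\<Omega>, id) F x v v \<le> 4 * ((r x)\<^sup>2 * (v \<bullet> v))"
    unfolding 5 using 3 by linarith
qed

section \<open>Embedding and unit normal\<close>

lemma F_in_hyperbolic_space:
  assumes "x \<in> \<Omega>"
  shows "F x \<in> hyperbolic_space"
proof -
  have "0 < fst (F x)"
    using r_pos[OF assms] by (simp add: G_def W_def mk_def add_pos_nonneg)
  then show ?thesis by (simp add: hyperbolic_space_def lorentz_G_G[OF assms])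
qed

lemma smooth_immersion_F: "smooth_immersion (top_of_set \<Omega>) atlas F"
proof -
  have "inj (dG 2 (sqrt 3) x)" if x: "x \<in> \<Omega>" for x
  proof -
    have "linear (dG 2 (sqrt 3) x)" using has_derivative_G[OF x] has_derivative_linear by blast
    moreover have "v = 0" if "dG 2 (sqrt 3) x v = 0" for v
    proof -
      have "ind_metric (\<Omega>, id) F x v v = 0"
        using that by (simp add: ind_metric_def dmap_G[OF x] lorentz_def)
      then have "(r x)\<^sup>2 * (v \<bullet> v) \<le> 0" using ind_metric_bounds(1)[OF x, of v] by (simp add: mult.commute)
      then show "v = 0" using r_pos[OF x] by (simp add: mult_le_0_iff power2_eq_square)
        (metis inner_eq_zero_iff inner_ge_zero order_antisym)
    qed
    ultimately show ?thesis by (simp add: linear_injective_0)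
  qed
  then show ?thesis
    using F_in_hyperbolic_space
    by (auto simp: smooth_immersion_def smooth_map_open[OF open_Omega] smooth_on_G dmap_G)
qed

lemma embedding_map_F: "embedding_map (top_of_set \<Omega>) (top_of_set hyperbolic_space) F"
proof -
  \<comment> \<open>In this null coordinate the terms |x|^2 of \<open>F x\<close> cancel, and it
    reads off 2 r.\<close>
  define t where "t y = fst y + snd y \<bullet> e" for y :: "real \<times> 'e"
  define u where "u y = adjoint E (snd y)" for y :: "real \<times> 'e"
  \<comment> \<open>\<open>u (F x)\<close> is r times x with y scaled by sqrt 3 and z by 2. The
    coefficients act as 1 / sqrt 3 on the range of \<open>P\<close> and as 1 / 2 on its kernel, and
    2 / t removes r. This left inverse is continuous on the image.\<close>
  define K where "K y = (2 / t y) *\<^sub>R ((1 / 2) *\<^sub>R u y + (1 / sqrt 3 - 1 / 2) *\<^sub>R P (u y))"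
    for y :: "real \<times> 'e"
  have adjE: "adjoint E (E z) = z" for z
    by (rule vector_eq_ldot[THEN iffD1]) (metis adjoint_works[OF linear_E] inner_E inner_commute)
  have adje: "adjoint E e = 0"
    using adjoint_works[OF linear_E, of "adjoint E e" e] inner_E_e
    by (metis inner_commute inner_eq_zero_iff)
  have lin: "linear (adjoint E)" by (rule adjoint_linear[OF linear_E])
  have tF: "t (F x) = 2 * r x" for x
    by (simp add: t_def G_def W_def mk_def inner_add_left inner_e inner_E_e algebra_simps)
  have uF: "u (F x) = r x *\<^sub>R (2 *\<^sub>R x + (sqrt 3 - 2) *\<^sub>R P x)" for x
    by (simp add: u_def G_def W_def mk_def linear_add[OF lin] linear_cmul[OF lin] adjE adje)
  have KF: "K (F x) = x" if x: "x \<in> \<Omega>" for x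
  proof -
    have PuF: "P (u (F x)) = (r x * sqrt 3) *\<^sub>R P x"
      by (simp add: uF linear_add[OF linear_P] linear_cmul[OF linear_P] flip: scaleR_add_left)
    have "(1 / 2) *\<^sub>R u (F x) + (1 / sqrt 3 - 1 / 2) *\<^sub>R P (u (F x)) =
        (1 / 2) *\<^sub>R (r x *\<^sub>R (2 *\<^sub>R x + (sqrt 3 - 2) *\<^sub>R P x)) + (1 / sqrt 3 - 1 / 2) *\<^sub>R ((r x * sqrt 3) *\<^sub>R P x)"
      by (simp only: PuF) (simp only: uF)
    also have "\<dots> = r x *\<^sub>R x"
      by (simp add: vec_eq_iff field_simps)
    finally have "(1 / 2) *\<^sub>R u (F x) + (1 / sqrt 3 - 1 / 2) *\<^sub>R P (u (F x)) = r x *\<^sub>R x" .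
    then show ?thesis
      using r_pos[OF x] unfolding K_def tF by simp
  qed
  have "continuous_on (F ` \<Omega>) K"
  proof -
    have "continuous_on (F ` \<Omega>) u" unfolding u_def
      using lin linear_conv_bounded_linear
      by (intro bounded_linear.continuous_on[of "adjoint E"] continuous_intros) blast
    moreover then have "continuous_on (F ` \<Omega>) (\<lambda>y. P (u y))"
      by (rule bounded_linear.continuous_on[OF bounded_linear_P])
    moreover have "t y \<noteq> 0" if "y \<in> F ` \<Omega>" for y
      using that tF r_pos by fastforce
    moreover have "continuous_on (F ` \<Omega>) t"
      unfolding t_def by (intro continuous_intros)
    ultimately show ?thesis unfolding K_def by (intro continuous_intros) auto
  qed
  moreover have "continuous_on \<Omega> F"
    using smooth_on_imp_continuous_on_derivative(1)[OF smooth_on_G] .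
  ultimately have "homeomorphic_maps (top_of_set \<Omega>) (top_of_set (F ` \<Omega>)) F K"
    using KF by (auto simp: homeomorphic_maps_def)
  moreover have "subtopology (top_of_set hyperbolic_space) (F ` \<Omega>) = top_of_set (F ` \<Omega>)"
    using F_in_hyperbolic_space by (simp add: subtopology_subtopology image_subset_iff inf.absorb2)
  ultimately show ?thesis
    by (simp add: embedding_map_def homeomorphic_maps_imp_map)
qed

lemma smooth_embedding_F: "smooth_embedding (top_of_set \<Omega>) atlas F"
  by (simp add: smooth_embedding_def smooth_immersion_F embedding_map_F)

lemma unit_normal_N: "unit_normal (top_of_set \<Omega>) atlas F N"
proof -
  have "lorentz (N x) (dG 2 (sqrt 3) x v) = 0" if "x \<in> \<Omega>" for x v
    using lorentz_dG_G[OF that] by (metis lorentz_commute)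
  then show ?thesis
    by (simp add: unit_normal_def smooth_map_open[OF open_Omega] smooth_on_G lorentz_G_G dmap_G)
qed

section \<open>Coordinate matrices, curvatures and volume density\<close>

definition u :: "real ^ 'n \<Rightarrow> 'n \<Rightarrow> real" where
  "u x i = r x * P x $ i"

definition d :: "'n \<Rightarrow> real" where
  "d i = (if i \<in> I then 3 else 4)"

lemma u_outside: "i \<notin> I \<Longrightarrow> u x i = 0"
  by (simp add: u_def P_nth)

lemma sum_u_sq: "x \<in> \<Omega> \<Longrightarrow> (\<Sum>i\<in>UNIV. (u x i)\<^sup>2) = 1"
proof -
  assume "x \<in> \<Omega>"
  have "(\<Sum>i\<in>UNIV. (u x i)\<^sup>2) = (r x)\<^sup>2 * (P x \<bullet> P x)"
    by (simp add: u_def inner_vec_def power2_eq_square sum_distrib_left mult_ac del: inner_P)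
  then show ?thesis using r_sq[OF \<open>x \<in> \<Omega>\<close>] by simp
qed

text \<open>The unit vector \<open>u x\<close> = y / |y| is supported on \<open>I\<close>, where
  \<open>d\<close> is 3. It is thus an eigenvector of the diagonal part of the metric, and the
  rank-one formulas below collapse to constants.\<close>

lemma d_u: "d i * u x i = 3 * u x i" "u x i / d i = u x i / 3"
  by (auto simp: d_def u_outside)

lemma gram_F:
  assumes "x \<in> \<Omega>"
  shows "gram (\<Omega>, id) F x $ i $ j = (r x)\<^sup>2 * ((if i = j then d i else 0) + u x i * u x j)"
proof -
  have "P (axis i 1) \<bullet> axis j 1 = (if i = j \<and> i \<in> I then 1 else 0 :: real)"
    by (subst cart_eq_inner_axis[symmetric]) (auto simp: P_nth axis_def)
  moreover have "(axis i 1 :: real ^ 'n) \<bullet> axis j 1 = (if i = j then 1 else 0 :: real)"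
    by (simp add: inner_axis_axis)
  ultimately show ?thesis
    by (simp add: gram_def ind_metric_F[OF assms] d_def u_def cart_eq_inner_axis[symmetric]
        power2_eq_square power4_eq_xxxx algebra_simps)
qed

lemma second_form_matrix_F:
  assumes "x \<in> \<Omega>"
  shows "second_form_matrix (\<Omega>, id) F N x $ i $ j = (if i = j then 2 * sqrt 3 * (r x)\<^sup>2 else 0)"
  by (simp add: second_form_matrix_def second_form_F[OF assms] inner_axis_axis)

text \<open>The Sherman-Morrison formula for diag(d) + u u^T: the diagonal inverse sends u to u / 3,
  and the coefficient is (1/9) / (1 + 1/3) = 1/12.\<close>

lemma inverse_gram_F:
  assumes "x \<in> \<Omega>"
  shows "matrix_inv (gram (\<Omega>, id) F x) $ i $ j =
    ((if i = j then 1 / d i else 0) - u x i * u x j / 12) / (r x)\<^sup>2"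
proof -
  define M' where "M' = (\<chi> i j. ((if i = j then 1 / d i else 0) - u x i * u x j / 12) / (r x)\<^sup>2)"
  have "(gram (\<Omega>, id) F x ** M') $ i $ j = (mat 1 :: real ^ 'n ^ 'n) $ i $ j" for i j
  proof -
    have "(gram (\<Omega>, id) F x ** M') $ i $ j =
       (\<Sum>k\<in>UNIV. ((if i = k then d i else 0) + u x i * u x k) *
          ((if k = j then 1 / d k else 0) - u x k * u x j / 12))"
      using r_pos[OF assms] by (simp add: matrix_matrix_mult_def gram_F[OF assms] M'_def)
    also have "\<dots> = (\<Sum>k\<in>UNIV. (if i = k then if k = j then d i / d k else 0 else 0)
        - (if i = k then d i * u x k * u x j / 12 else 0) + (if k = j then u x i * (u x k / d k) else 0)
        - u x i * u x j / 12 * (u x k)\<^sup>2)"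
      by (intro sum.cong) (auto simp: algebra_simps power2_eq_square)
    also have "\<dots> = (if i = j then d i / d j else 0) - (d i * u x i) * u x j / 12 + u x i * (u x j / d j)
        - u x i * u x j / 12"
      by (simp only: sum.distrib sum_subtractf sum_distrib_left[symmetric] sum_u_sq[OF assms]) simp
    also have "\<dots> = (if i = j then 1 else 0)"
      unfolding d_u by (simp add: d_def)
    finally show ?thesis by (simp add: mat_def)
  qed
  then have "matrix_inv (gram (\<Omega>, id) F x) = M'"
    by (intro matrix_inv_eq) (simp add: vec_eq_iff)
  then show ?thesis by (simp add: M'_def)
qed

text \<open>The second form has matrix 2 sqrt 3 r^2 times the identity, so its trace is 2 sqrt 3
  (4/3 + 2/4 - 1/12) = 7 sqrt 3 / 2, to be divided by 6.\<close>

lemma mean_curvature_F: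
  assumes "x \<in> \<Omega>" "card I = 4" "card (- I) = 2"
  shows "mean_curvature atlas F N x = 7 * sqrt 3 / 12"
proof -
  have card: "CARD('n) = 6"
    using assms card_Un_disjoint[of I "- I"] by (simp add: Un_commute)
  have "(\<Sum>i\<in>UNIV. 1 / d i) = (\<Sum>i\<in>I. 1 / d i) + (\<Sum>i\<in>- I. 1 / d i)"
    by (subst sum.union_disjoint[symmetric]) auto
  also have "\<dots> = 11 / 6" by (simp add: d_def assms)
  finally have sd: "(\<Sum>i\<in>UNIV. 1 / d i) = 11 / 6" .
  have "(\<Sum>i\<in>UNIV. \<Sum>j\<in>UNIV. matrix_inv (gram (\<Omega>, id) F x) $ i $ j *
      second_form_matrix (\<Omega>, id) F N x $ i $ j) = (\<Sum>i\<in>UNIV. 2 * sqrt 3 * (1 / d i - (u x i)\<^sup>2 / 12))"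
    using r_pos[OF assms(1)]
    by (simp add: inverse_gram_F[OF assms(1)] second_form_matrix_F[OF assms(1)] if_distrib
        power2_eq_square mult.commute cong: if_cong) (simp add: mult.assoc)
  also have "\<dots> = 2 * sqrt 3 * ((\<Sum>i\<in>UNIV. 1 / d i) - (\<Sum>i\<in>UNIV. (u x i)\<^sup>2) / 12)"
    by (simp only: sum_distrib_left[symmetric] sum_subtractf sum_divide_distrib[symmetric])
  also have "\<dots> = 7 * sqrt 3 / 2"
    by (simp add: sd sum_u_sq[OF assms(1)])
  finally show ?thesis
    by (simp add: mean_curvature_def chart_at_singleton assms(1) card Let_def)
qed

text \<open>Contracting with a multiple of the identity leaves 12 times the sum of the squared
  entries of diag(1/d) - u u^T / 12. With 4/9 + 2/16 = 41/72 this is 12 (41/72) - 2/3 +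
  1/12.\<close>

lemma norm_second_form_sq_F:
  assumes "x \<in> \<Omega>" "card I = 4" "card (- I) = 2"
  shows "norm_second_form_sq atlas F N x = 25 / 4"
proof -
  let ?g = "matrix_inv (gram (\<Omega>, id) F x)" and ?a = "second_form_matrix (\<Omega>, id) F N x"
  have "(\<Sum>i\<in>UNIV. 1 / (d i)\<^sup>2) = (\<Sum>i\<in>I. 1 / (d i)\<^sup>2) + (\<Sum>i\<in>- I. 1 / (d i)\<^sup>2)"
    by (subst sum.union_disjoint[symmetric]) auto
  also have "\<dots> = 41 / 72" by (simp add: d_def assms)
  finally have sd: "(\<Sum>i\<in>UNIV. 1 / (d i)\<^sup>2) = 41 / 72" .
  have "(\<Sum>i\<in>UNIV. \<Sum>j\<in>UNIV. \<Sum>k\<in>UNIV. \<Sum>l\<in>UNIV.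
           ?g $ i $ k * ?g $ j $ l * ?a $ i $ j * ?a $ k $ l)
      = (\<Sum>i\<in>UNIV. \<Sum>k\<in>UNIV. ?g $ i $ k * ?g $ i $ k * (2 * sqrt 3 * (r x)\<^sup>2) * (2 * sqrt 3 * (r x)\<^sup>2))"
  proof (rule sum.cong[OF refl])
    fix i :: 'n
    have "(\<Sum>j\<in>UNIV. \<Sum>k\<in>UNIV. \<Sum>l\<in>UNIV. ?g $ i $ k * ?g $ j $ l * ?a $ i $ j * ?a $ k $ l)
       = (\<Sum>j\<in>UNIV. if i = j then \<Sum>k\<in>UNIV. \<Sum>l\<in>UNIV. ?g $ i $ k * ?g $ j $ l * (2 * sqrt 3 * (r x)\<^sup>2) * ?a $ k $ l else 0)"
      by (intro sum.cong) (auto simp: second_form_matrix_F[OF assms(1)])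
    also have "\<dots> = (\<Sum>k\<in>UNIV. \<Sum>l\<in>UNIV. ?g $ i $ k * ?g $ i $ l * (2 * sqrt 3 * (r x)\<^sup>2) * ?a $ k $ l)"
      by simp
    also have "\<dots> = (\<Sum>k\<in>UNIV. \<Sum>l\<in>UNIV. if k = l then ?g $ i $ k * ?g $ i $ l * (2 * sqrt 3 * (r x)\<^sup>2) * (2 * sqrt 3 * (r x)\<^sup>2) else 0)"
      by (intro sum.cong) (auto simp: second_form_matrix_F[OF assms(1)])
    finally show "(\<Sum>j\<in>UNIV. \<Sum>k\<in>UNIV. \<Sum>l\<in>UNIV. ?g $ i $ k * ?g $ j $ l * ?a $ i $ j * ?a $ k $ l)
       = (\<Sum>k\<in>UNIV. ?g $ i $ k * ?g $ i $ k * (2 * sqrt 3 * (r x)\<^sup>2) * (2 * sqrt 3 * (r x)\<^sup>2))"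
      by simp
  qed
  also have "\<dots> = (\<Sum>i\<in>UNIV. \<Sum>k\<in>UNIV. 12 * ((if i = k then 1 / d i else 0) - u x i * u x k / 12)\<^sup>2)"
    using r_pos[OF assms(1)]
    by (intro sum.cong refl) (simp add: inverse_gram_F[OF assms(1)] power2_eq_square)
  also have "\<dots> = (\<Sum>i\<in>UNIV. \<Sum>k\<in>UNIV. (if i = k then 12 / (d i)\<^sup>2 - 2 * (u x i / d i) * u x k else 0)
      + (u x i)\<^sup>2 * (u x k)\<^sup>2 / 12)"
    by (intro sum.cong refl) (auto simp: power2_eq_square algebra_simps)
  also have "\<dots> = (\<Sum>i\<in>UNIV. 12 * (1 / (d i)\<^sup>2) - 2 * (u x i / d i) * u x i) + 1 / 12"
    by (simp add: sum.distrib sum_distrib_left[symmetric] sum_divide_distrib[symmetric]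
        sum_u_sq[OF assms(1)])
  also have "\<dots> = (\<Sum>i\<in>UNIV. 12 * (1 / (d i)\<^sup>2) - 2 / 3 * (u x i)\<^sup>2) + 1 / 12"
    by (simp add: d_u power2_eq_square mult.assoc)
  also have "\<dots> = 12 * (\<Sum>i\<in>UNIV. 1 / (d i)\<^sup>2) - 2 / 3 * (\<Sum>i\<in>UNIV. (u x i)\<^sup>2) + 1 / 12"
    by (simp only: sum_distrib_left[symmetric] sum_subtractf)
  also have "\<dots> = 25 / 4"
    by (simp add: sd sum_u_sq[OF assms(1)])
  finally show ?thesis
    by (simp add: norm_second_form_sq_def chart_at_singleton assms(1) Let_def)
qed

text \<open>The radial vector \<open>P x\<close> has squared length 4 in the induced metric, so this
  is Cauchy-Schwarz for the gradient. In coordinates, S^2 / 3 bounds the diagonal part from below,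
  and 1/3 - 1/12 = 1/4.\<close>

lemma norm_grad_sq_ge:
  assumes x: "x \<in> \<Omega>" and f: "(f has_derivative D) (at x)"
  shows "(D (P x))\<^sup>2 / 4 \<le> norm_grad_sq atlas F f x"
proof -
  let ?g = "matrix_inv (gram (\<Omega>, id) F x)"
  define y where "y i = D (axis i 1)" for i
  define S where "S = (\<Sum>i\<in>UNIV. u x i * y i)"
  have lin: "linear D" using f has_derivative_linear by blast
  have "D (P x) = (\<Sum>i\<in>UNIV. P x $ i * y i)"
    unfolding y_def
    by (subst basis_expansion[of "P x", symmetric])
      (simp add: linear_sum[OF lin] linear_cmul[OF lin] scalar_mult_eq_scaleR)
  then have DP: "r x * D (P x) = S"
    by (simp add: S_def u_def sum_distrib_left mult.assoc)
  have "norm_grad_sq atlas F f x = (\<Sum>i\<in>UNIV. \<Sum>j\<in>UNIV. ?g $ i $ j * y i * y j)"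
    by (simp add: norm_grad_sq_def chart_at_singleton x dmap_open[OF open_Omega x f] y_def)
  also have "\<dots> = (\<Sum>i\<in>UNIV. \<Sum>j\<in>UNIV. (if i = j then (y i)\<^sup>2 / d i / (r x)\<^sup>2 else 0)
      - (u x i * y i) * (u x j * y j) / (12 * (r x)\<^sup>2))"
    by (intro sum.cong refl) (auto simp: inverse_gram_F[OF x] diff_divide_distrib algebra_simps power2_eq_square)
  also have "\<dots> = (\<Sum>i\<in>UNIV. (y i)\<^sup>2 / d i / (r x)\<^sup>2) - S * S / (12 * (r x)\<^sup>2)"
    by (simp add: sum_subtractf sum_distrib_left[symmetric] sum_distrib_right[symmetric]
        sum_divide_distrib[symmetric] S_def)
  also have "\<dots> = ((\<Sum>i\<in>UNIV. (y i)\<^sup>2 / d i) - S\<^sup>2 / 12) / (r x)\<^sup>2"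
    by (simp add: sum_divide_distrib diff_divide_distrib power2_eq_square)
  finally have eq: "norm_grad_sq atlas F f x = ((\<Sum>i\<in>UNIV. (y i)\<^sup>2 / d i) - S\<^sup>2 / 12) / (r x)\<^sup>2" .
  have "S\<^sup>2 = (\<Sum>i\<in>I. u x i * y i)\<^sup>2"
    unfolding S_def by (rule arg_cong[where f = "\<lambda>t. t\<^sup>2"], rule sum.mono_neutral_right) (auto simp: u_outside)
  also have "\<dots> \<le> (\<Sum>i\<in>I. (u x i)\<^sup>2) * (\<Sum>i\<in>I. (y i)\<^sup>2)"
    by (rule Cauchy_Schwarz_ineq_sum)
  also have "(\<Sum>i\<in>I. (u x i)\<^sup>2) = 1"
    using sum_u_sq[OF x] by (subst sum.mono_neutral_left[of UNIV]) (auto simp: u_outside)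
  also have "1 * (\<Sum>i\<in>I. (y i)\<^sup>2) = 3 * (\<Sum>i\<in>I. (y i)\<^sup>2 / d i)"
    by (simp add: d_def sum_distrib_left)
  also have "\<dots> \<le> 3 * (\<Sum>i\<in>UNIV. (y i)\<^sup>2 / d i)"
    by (intro mult_left_mono sum_mono2) (auto simp: d_def)
  finally have "S\<^sup>2 / 4 \<le> (\<Sum>i\<in>UNIV. (y i)\<^sup>2 / d i) - S\<^sup>2 / 12" by simp
  then have "S\<^sup>2 / 4 / (r x)\<^sup>2 \<le> norm_grad_sq atlas F f x"
    unfolding eq by (intro divide_right_mono) auto
  moreover have "S\<^sup>2 / 4 / (r x)\<^sup>2 = (D (P x))\<^sup>2 / 4"
    using r_pos[OF x] by (simp add: DP[symmetric] power_mult_distrib)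
  ultimately show ?thesis by simp
qed

text \<open>The six factors r^2 give r^12, the diagonal gives 3^4 4^2 = 1296, and the rank-one term
  gives the factor 1 + 1/3.\<close>

lemma det_gram_F:
  assumes x: "x \<in> \<Omega>" and card: "card I = 4" "card (- I) = 2"
  shows "det (gram (\<Omega>, id) F x) = 1728 * (r x) ^ 12"
proof -
  have UN: "UNIV = I \<union> - I" "I \<inter> - I = {}" by auto
  have card6: "CARD('n) = 6"
    using card card_Un_disjoint[of I "- I"] by (simp add: Un_commute)
  let ?v = "\<chi> j. (r x)\<^sup>2 * u x j"
  have "gram (\<Omega>, id) F x = (\<chi> i j. (if i = j then (r x)\<^sup>2 * d i else 0) + u x i * ?v $ j)"
    by (simp add: vec_eq_iff gram_F[OF x] algebra_simps)
  also have "det \<dots> = (\<Prod>i\<in>UNIV. (r x)\<^sup>2 * d i) * (1 + (\<Sum>i\<in>UNIV. u x i * ?v $ i / ((r x)\<^sup>2 * d i)))"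
    using r_pos[OF x] by (intro det_diag_plus_rank_one) (simp add: d_def)
  also have "(\<Sum>i\<in>UNIV. u x i * ?v $ i / ((r x)\<^sup>2 * d i)) = (\<Sum>i\<in>UNIV. (u x i)\<^sup>2 / 3)"
    using r_pos[OF x] by (intro sum.cong refl) (auto simp: d_def u_outside power2_eq_square)
  also have "\<dots> = 1 / 3" using sum_u_sq[OF x] by (simp add: sum_divide_distrib[symmetric])
  also have "(\<Prod>i\<in>UNIV. (r x)\<^sup>2 * d i) = (r x) ^ 12 * ((\<Prod>i\<in>I. d i) * (\<Prod>i\<in>- I. d i))"
    by (subst prod.union_disjoint[symmetric]) (simp_all add: prod.distrib card6 flip: power_mult)
  also have "(\<Prod>i\<in>I. d i) * (\<Prod>i\<in>- I. d i) = 1296"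
    by (simp add: d_def card)
  also have "(r x) ^ 12 * 1296 * (1 + 1 / 3) = 1728 * (r x) ^ 12" by simp
  finally show ?thesis .
qed

section \<open>Stability\<close>

text \<open>The Hardy inequality for radial derivatives holds with its sharp constant because
  \<open>r\<^sup>6 ((D f y)\<^sup>2 - f\<^sup>2) - r\<^sup>6 (2 f D f y - 2 f\<^sup>2)\<close> is \<open>r\<^sup>6 (D f y - f)\<^sup>2\<close>, and the second term is the
  divergence of the compactly supported field \<open>f\<^sup>2 r\<^sup>6 y\<close>.\<close>

lemma has_derivative_hardy_field:
  assumes f: "smooth_on \<Omega> f" and K: "compact K" "K \<subseteq> \<Omega>" "\<And>x. x \<in> \<Omega> - K \<Longrightarrow> f x = 0"
  defines "\<phi> \<equiv> \<lambda>i x. if x \<in> \<Omega> then (f x)\<^sup>2 * (r x)^6 * x $ i else 0"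
    and "D \<equiv> \<lambda>i x v. if x \<in> \<Omega> then 2 * f x * frechet_derivative f (at x) v * (r x)^6 * x $ i
      - 6 * (f x)\<^sup>2 * (r x)^8 * (P x \<bullet> v) * x $ i + (f x)\<^sup>2 * (r x)^6 * v $ i else 0"
  shows "(\<phi> i has_derivative D i x) (at x)" and "continuous_on UNIV (\<lambda>x. D i x v)"
proof -
  note f' = smooth_on_imp_continuous_on_derivative[OF f]
  have D0: "D i x = (\<lambda>v. 0)" and \<phi>0: "\<phi> i x = 0" if "x \<notin> K" for i x
    using that K(3)[of x] by (auto simp: D_def \<phi>_def)
  have nth: "((\<lambda>x. x $ i) has_derivative (\<lambda>v. v $ i)) (at x)" for x :: "real ^ 'n"
    by (rule bounded_linear_imp_has_derivative[OF bounded_linear_vec_nth])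
  show "(\<phi> i has_derivative D i x) (at x)"
  proof (cases "x \<in> \<Omega>")
    case True
    have "((\<lambda>x. (f x)\<^sup>2 * (r x)^6 * x $ i) has_derivative D i x) (at x)"
      by (rule derivative_eq_intros f'(2)[OF True] has_derivative_r[OF True] nth refl)+
        (simp add: D_def True fun_eq_iff power_eq_if algebra_simps)
    then show ?thesis
      by (rule has_derivative_transform_within_open[OF _ open_Omega True]) (simp add: \<phi>_def)
  next
    case False
    then have "x \<notin> K" using K(2) by auto
    \<comment> \<open>Outside \<open>\<Omega>\<close> the point lies in the open set
      \<open>- K\<close>, on which the field vanishes. \<open>\<Omega>\<close> and
      \<open>- K\<close> cover the space, so extension by zero loses no regularity; continuity of
      the derivative below uses the same cover.\<close>
    show ?thesis
      unfolding D0[OF \<open>x \<notin> K\<close>]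
      by (rule has_derivative_transform_within_open[OF has_derivative_const[of 0], of "- K"])
        (use K(1) \<open>x \<notin> K\<close> \<phi>0 compact_imp_closed in auto)
  qed
  have cr: "continuous_on \<Omega> r" using Ck_on_r[of 0] by simp
  have "continuous_on \<Omega> (\<lambda>x. 2 * f x * frechet_derivative f (at x) v * (r x)^6 * x $ i
      - 6 * (f x)\<^sup>2 * (r x)^8 * (P x \<bullet> v) * x $ i + (f x)\<^sup>2 * (r x)^6 * v $ i)"
    by (intro continuous_intros f'(1,3) cr bounded_linear.continuous_on[OF bounded_linear_P])
  then have "continuous_on \<Omega> (\<lambda>x. D i x v)"
    by (simp add: D_def cong: continuous_on_cong)
  moreover have "continuous_on (- K) (\<lambda>x. D i x v)"
    by (rule continuous_on_eq[OF continuous_on_const[of _ 0]]) (simp add: D0)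
  moreover have "\<Omega> \<union> - K = UNIV" using K(2) by auto
  ultimately show "continuous_on UNIV (\<lambda>x. D i x v)"
    using continuous_on_open_Un[OF open_Omega, of "- K"] K(1) compact_imp_closed by (metis open_Compl)
qed

text \<open>The function g is the divergence of the field in the y coordinates alone, and each
  summand integrates to 0. The coefficient -2 of f^2 is 4 - 6: the divergence of y contributes 4 and
  the radial derivative of r^6 contributes -6.\<close>

lemma integral_hardy_field:
  assumes f: "smooth_on \<Omega> f" and K: "compact K" "K \<subseteq> \<Omega>" "\<And>x. x \<in> \<Omega> - K \<Longrightarrow> f x = 0"
    and card: "card I = 4"
  defines "g \<equiv> \<lambda>x. if x \<in> \<Omega> then (r x)^6 * (2 * f x * frechet_derivative f (at x) (P x) - 2 * (f x)\<^sup>2) else 0"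
  shows "integrable lborel g" and "(\<integral>x. g x \<partial>lborel) = 0"
proof -
  define D where "D i x v = (if x \<in> \<Omega> then 2 * f x * frechet_derivative f (at x) v * (r x)^6 * x $ i
      - 6 * (f x)\<^sup>2 * (r x)^8 * (P x \<bullet> v) * x $ i + (f x)\<^sup>2 * (r x)^6 * v $ i else 0)" for i x v
  define \<phi> where "\<phi> i x = (if x \<in> \<Omega> then (f x)\<^sup>2 * (r x)^6 * x $ i else 0)" for i x
  note der = has_derivative_hardy_field[OF f K, folded D_def \<phi>_def]
  have \<phi>0: "\<phi> i x = 0" if "x \<notin> K" for i x
    using that K(3)[of x] by (auto simp: \<phi>_def)
  have int: "integrable lborel (\<lambda>x. D i x (axis i 1))" "(\<integral>x. D i x (axis i 1) \<partial>lborel) = 0" for i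
    using integral_derivative_compact_support[of "\<phi> i" "D i" "axis i 1" K] der K(1) \<phi>0 by blast+
  have g: "g x = (\<Sum>i\<in>I. D i x (axis i 1))" for x
  proof (cases "x \<in> \<Omega>")
    case True
    let ?f' = "frechet_derivative f (at x)"
    have lin: "linear ?f'"
      using smooth_on_imp_continuous_on_derivative(2)[OF f True] has_derivative_linear by blast
    have "P x = (\<Sum>i\<in>I. x $ i *\<^sub>R axis i 1)"
      by (simp add: vec_eq_iff P_nth axis_def if_distrib cong: if_cong)
    then have f'P: "?f' (P x) = (\<Sum>i\<in>I. ?f' (axis i 1) * x $ i)"
      by (simp add: linear_sum[OF lin] linear_cmul[OF lin] mult.commute)
    have Pxx: "P x \<bullet> x = (\<Sum>i\<in>I. x $ i * x $ i)"
      unfolding inner_vec_def by (rule sum.mono_neutral_cong_right) (auto simp: P_nth)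
    have "(\<Sum>i\<in>I. D i x (axis i 1)) = (\<Sum>i\<in>I. 2 * f x * (r x)^6 * (?f' (axis i 1) * x $ i)
        - 6 * (f x)\<^sup>2 * (r x)^8 * (x $ i * x $ i) + (f x)\<^sup>2 * (r x)^6)"
      by (intro sum.cong refl)
        (simp add: D_def True cart_eq_inner_axis[symmetric] P_nth mult_ac)
    also have "\<dots> = 2 * f x * (r x)^6 * ?f' (P x) - 6 * (f x)\<^sup>2 * (r x)^8 * (P x \<bullet> x) + 4 * (f x)\<^sup>2 * (r x)^6"
      unfolding f'P Pxx by (simp add: sum.distrib sum_subtractf sum_distrib_left card)
    also have "\<dots> = 2 * f x * (r x)^6 * ?f' (P x) - 6 * (f x)\<^sup>2 * (r x)^6 * ((r x)\<^sup>2 * (P x \<bullet> x))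
        + 4 * (f x)\<^sup>2 * (r x)^6"
      using power_add[of "r x" 6 2] by simp
    also have "\<dots> = g x"
      unfolding r_sq[OF True] by (simp add: g_def True algebra_simps)
    finally show ?thesis by simp
  qed (simp add: g_def D_def)
  show "integrable lborel g" "(\<integral>x. g x \<partial>lborel) = 0"
    unfolding g using int by (simp_all add: Bochner_Integration.integral_sum)
qed

text \<open>The density is sqrt 1728 r^6 and the potential is 25/4 - 6 = 1/4. The weighted integrand
  therefore dominates sqrt 1728 / 4 times the divergence, whose integral is 0.\<close>

lemma strongly_stable_F:
  assumes card: "card I = 4" "card (- I) = 2"
  shows "strongly_stable (top_of_set \<Omega>) atlas F N"
  unfolding strongly_stable_def
proof (intro allI impI)
  fix f assume "test_function (top_of_set \<Omega>) atlas f"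
  then obtain K where f: "smooth_on \<Omega> f" and K: "compact K" "K \<subseteq> \<Omega>" "\<And>x. x \<in> \<Omega> - K \<Longrightarrow> f x = 0"
    by (auto simp: test_function_def smooth_map_open[OF open_Omega] compactin_subtopology)
  have card6: "CARD('n) = 6"
    using card card_Un_disjoint[of I "- I"] by (simp add: Un_commute)
  define h where "h x = norm_grad_sq atlas F f x - (norm_second_form_sq atlas F N x - real CARD('n)) * (f x)\<^sup>2" for x
  define w where "w x = sqrt (det (gram (\<Omega>, id) F x))" for x
  define g where "g x = (if x \<in> \<Omega> then (r x)^6 * (2 * f x * frechet_derivative f (at x) (P x) - 2 * (f x)\<^sup>2) else 0)" for x
  note g = integral_hardy_field[OF f K card(1), folded g_def]
  have cr: "continuous_on \<Omega> r" using Ck_on_r[of 0] by simp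
  have cont: "continuous_on \<Omega> (\<lambda>x. det (gram (\<Omega>, id) F x))"
    using det_gram_F[OF _ card] by (simp cong: continuous_on_cong) (intro continuous_intros cr)
  have w: "w x = sqrt 1728 * (r x)^6" if "x \<in> \<Omega>" for x
    using r_pos[OF that] real_sqrt_abs[of "(r x)^6"]
    by (simp add: w_def det_gram_F[OF that card] real_sqrt_mult flip: power_mult)
  have pointwise: "sqrt 1728 / 4 * g x \<le> indicator \<Omega> x *\<^sub>R (w x * h x)" for x
  proof (cases "x \<in> \<Omega>")
    case True
    let ?f' = "frechet_derivative f (at x)"
    have "(?f' (P x))\<^sup>2 / 4 - (f x)\<^sup>2 / 4 \<le> h x"
      using norm_grad_sq_ge[OF True smooth_on_imp_continuous_on_derivative(2)[OF f True]]
      by (simp add: h_def norm_second_form_sq_F[OF True card] card6)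
    moreover have "0 \<le> (?f' (P x) - f x)\<^sup>2" by simp
    then have "2 * f x * ?f' (P x) - 2 * (f x)\<^sup>2 \<le> (?f' (P x))\<^sup>2 - (f x)\<^sup>2"
      by (simp add: power2_diff algebra_simps)
    ultimately have "(2 * f x * ?f' (P x) - 2 * (f x)\<^sup>2) / 4 \<le> h x" by simp
    then have "w x * ((2 * f x * ?f' (P x) - 2 * (f x)\<^sup>2) / 4) \<le> w x * h x"
      using r_pos[OF True] by (intro mult_left_mono) (auto simp: w[OF True])
    then show ?thesis using True by (simp add: g_def w)
  qed (simp add: g_def)
  let ?M = "restrict_space lborel \<Omega>"
  have vol: "riemannian_volume (top_of_set \<Omega>) atlas F = density ?M (\<lambda>x. ennreal (w x))"
    unfolding w_def by (rule riemannian_volume_open[OF open_Omega cont])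
  have "0 \<le> (\<integral>x. h x \<partial>density ?M (\<lambda>x. ennreal (w x)))"
  \<comment> \<open>A function that is not integrable has Bochner integral 0, which settles that
    case. In the other case integrability also supplies the measurability of h.\<close>
  proof (cases "integrable (density ?M (\<lambda>x. ennreal (w x))) h")
    case True
    have "h \<in> borel_measurable ?M"
      using borel_measurable_integrable[OF True] by simp
    moreover have wm: "w \<in> borel_measurable ?M"
    proof -
      have "w \<in> borel_measurable (restrict_space borel \<Omega>)"
        unfolding w_def by (intro borel_measurable_continuous_on_restrict continuous_intros cont)
      moreover have "sets ?M = sets (restrict_space borel \<Omega>)" by (simp add: sets_restrict_space)
      ultimately show ?thesis by (subst measurable_cong_sets[OF _ refl])
    qed
    moreover have "AE x in ?M. 0 \<le> w x"
      using r_pos by (intro AE_I2) (simp add: space_restrict_space w less_imp_le)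
    ultimately have eq: "(\<integral>x. h x \<partial>density ?M (\<lambda>x. ennreal (w x))) = (\<integral>x. w x * h x \<partial>?M)"
      and int: "integrable ?M (\<lambda>x. w x * h x)"
      using True integral_real_density[of w ?M h] integrable_real_density[of w ?M h] by auto
    have "integrable lborel (\<lambda>x. indicator \<Omega> x *\<^sub>R (w x * h x))"
      using int open_Omega by (subst (asm) integrable_restrict_space) auto
    then have "(\<integral>x. sqrt 1728 / 4 * g x \<partial>lborel) \<le> (\<integral>x. indicator \<Omega> x *\<^sub>R (w x * h x) \<partial>lborel)"
      using g(1) pointwise by (intro integral_mono) auto
    moreover have "(\<integral>x. indicator \<Omega> x *\<^sub>R (w x * h x) \<partial>lborel) = (\<integral>x. w x * h x \<partial>?M)"
      using open_Omega by (subst integral_restrict_space) auto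
    ultimately show ?thesis using g(2) eq by simp
  qed (simp add: not_integrable_integral_eq)
  then show "0 \<le> (\<integral>x. norm_grad_sq atlas F f x
      - (norm_second_form_sq atlas F N x - real CARD('n)) * (f x)\<^sup>2 \<partial>riemannian_volume (top_of_set \<Omega>) atlas F)"
    unfolding vol h_def .
qed

section \<open>Topology and completeness\<close>

lemma axis_in_Omega: "i \<in> I \<Longrightarrow> c \<noteq> 0 \<Longrightarrow> axis i c \<in> \<Omega>"
  by (auto simp: Omega_def vec_eq_iff P_nth axis_def)

text \<open>\<open>\<Omega>\<close> is the union of the half-spaces where a coordinate with index in
  \<open>I\<close> has a fixed sign. Each is convex, and half-spaces for different indices
  meet.\<close>

lemma connected_Omega:
  assumes "i \<in> I" "j \<in> I" "i \<noteq> j"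
  shows "connected \<Omega>"
proof -
  define H where "H k s = {x :: real ^ 'n. (s *\<^sub>R axis k 1) \<bullet> x > 0}" for k and s :: real
  have H: "x \<in> H k s \<longleftrightarrow> s * x $ k > 0" for x k s
    by (simp add: H_def inner_axis')
  have step: "connected_component \<Omega> x y" if "k \<in> I" "x \<in> H k s" "y \<in> H k s" for k s x y
  proof (rule connected_componentI[OF _ _ that(2,3)])
    show "connected (H k s)" unfolding H_def by (rule convex_connected[OF convex_halfspace_gt])
    show "H k s \<subseteq> \<Omega>"
    proof
      fix x assume "x \<in> H k s"
      then have "P x $ k \<noteq> 0" using that(1) by (auto simp: H P_nth)
      then show "x \<in> \<Omega>" by (auto simp: Omega_def)
    qed
  qed
  have to_base: "connected_component \<Omega> x (axis i 1)" if "x \<in> \<Omega>" for x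
  proof -
    obtain k where k: "k \<in> I" "x $ k \<noteq> 0"
      using \<open>x \<in> \<Omega>\<close> by (auto simp: Omega_def vec_eq_iff P_nth split: if_splits)
    define s where "s = sgn (x $ k)"
    have s: "s * s = 1" "x \<in> H k s" using k by (auto simp: s_def H sgn_if)
    show ?thesis
    proof (cases "k = i")
      case False
      have "connected_component \<Omega> x (axis i 1 + axis k s)"
        using False s by (intro step[OF k(1) s(2)]) (auto simp: H axis_def)
      also have "connected_component \<Omega> (axis i 1 + axis k s) (axis i 1)"
        using False by (intro step[OF assms(1), of _ 1]) (auto simp: H axis_def)
      finally (connected_component_trans) show ?thesis .
    next
      \<comment> \<open>Here x may lie in the half-space opposite to the base point, which is
        disjoint from the target; the detour passes through points with positive coordinate
        j.\<close>
      case True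
      have "connected_component \<Omega> x (axis i s + axis j 1)"
        using True s assms by (intro step[OF k(1) s(2)]) (auto simp: H axis_def)
      also have "connected_component \<Omega> (axis i s + axis j 1) (axis i 1 + axis j 1)"
        using assms by (intro step[OF assms(2), of _ 1]) (auto simp: H axis_def)
      also (connected_component_trans) have "connected_component \<Omega> (axis i 1 + axis j 1) (axis i 1)"
        using assms by (intro step[OF assms(1), of _ 1]) (auto simp: H axis_def)
      finally (connected_component_trans) show ?thesis .
    qed
  qed
  then show ?thesis
    unfolding connected_iff_connected_component
    by (meson connected_component_sym connected_component_trans)
qed

lemma not_compact_Omega:
  assumes "i \<in> I"
  shows "\<not> compact \<Omega>"
proof
  assume "compact \<Omega>"
  then obtain B where B: "\<And>x. x \<in> \<Omega> \<Longrightarrow> norm x \<le> B"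
    using compact_imp_bounded[of \<Omega>] by (auto simp: bounded_iff)
  have "norm (axis i (\<bar>B\<bar> + 1) :: real ^ 'n) \<le> B"
    by (rule B[OF axis_in_Omega[OF assms]]) simp
  moreover have "axis i (\<bar>B\<bar> + 1) = (\<bar>B\<bar> + 1) *\<^sub>R (axis i 1 :: real ^ 'n)"
    by (simp add: vec_eq_iff axis_def)
  ultimately show False by simp
qed

section \<open>Completeness of the induced metric\<close>

lemma r_norm_P: "x \<in> \<Omega> \<Longrightarrow> r x * norm (P x) = 1"
  by (simp add: r_def Omega_def)

lemma speed_F:
  assumes "\<gamma> t \<in> \<Omega>" "(\<gamma> has_vector_derivative v) (at t)"
  shows "speed atlas F \<gamma> t = sqrt (ind_metric (\<Omega>, id) F (\<gamma> t) v v)"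
  using assms by (simp add: speed_def chart_at_singleton vector_derivative_at Let_def)

text \<open>The lower metric bound gives r |v| <= sqrt (g(v, v)), so the derivative of \<psi> along
  the curve is at most the speed. The delicate point is integration, since that derivative may be
  unbounded near the exceptional times.\<close>

lemma curve_length_ge:
  assumes der: "\<And>x. x \<in> \<Omega> \<Longrightarrow> (\<psi> has_derivative D x) (at x)"
    and bound: "\<And>x v. x \<in> \<Omega> \<Longrightarrow> \<bar>D x v\<bar> \<le> r x * norm v"
    and \<gamma>: "piecewise_C1_curve (top_of_set \<Omega>) atlas \<gamma>"
  shows "ennreal (\<bar>\<psi> (\<gamma> 1) - \<psi> (\<gamma> 0)\<bar>) \<le> curve_length atlas F \<gamma>"
proof (cases "curve_length atlas F \<gamma> = top")
  case True
  then show ?thesis by simp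
next
  case False
  obtain S where cont: "continuous_on {0..1} \<gamma>" and in\<Omega>: "\<And>t. t \<in> {0..1} \<Longrightarrow> \<gamma> t \<in> \<Omega>"
    and "finite S" and C1: "\<gamma> C1_differentiable_on {t \<in> {0..1} - S. \<gamma> t \<in> \<Omega>}"
    using \<gamma> by (auto simp: piecewise_C1_curve_def Pi_iff)
  obtain \<gamma>' where \<gamma>': "\<And>t. t \<in> {0..1} - S \<Longrightarrow> (\<gamma> has_vector_derivative \<gamma>' t) (at t)"
    using C1 in\<Omega> by (auto simp: C1_differentiable_on_def)
  define k where "k t = D (\<gamma> t) (\<gamma>' t)" for t
  have "((\<lambda>t. \<psi> (\<gamma> t)) has_vector_derivative k t) (at t)" if "t \<in> {0..1} - S" for t
  proof -
    have "t \<in> {0..1}" using that by simp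
    note d = der[OF in\<Omega>[OF this]]
    have "((\<lambda>t. \<psi> (\<gamma> t)) has_derivative (\<lambda>s. D (\<gamma> t) (s *\<^sub>R \<gamma>' t))) (at t)"
      using has_derivative_compose[OF \<gamma>'[OF that, unfolded has_vector_derivative_def] d] .
    then show ?thesis
      using linear_cmul[OF has_derivative_linear[OF d]] by (simp add: has_vector_derivative_def k_def)
  qed
  moreover have "continuous_on {0..1} (\<lambda>t. \<psi> (\<gamma> t))"
    using in\<Omega> has_derivative_continuous[OF der]
    by (intro continuous_on_compose2[OF _ cont, of \<Omega> \<psi>] continuous_at_imp_continuous_on) auto
  \<comment> \<open>This is the gauge integral, which tolerates unbounded derivatives. Finite length
    then makes k absolutely integrable, so the Lebesgue integral exists and has the same
    value.\<close>
  ultimately have k: "(k has_integral (\<psi> (\<gamma> 1) - \<psi> (\<gamma> 0))) {0..1}"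
    using \<open>finite S\<close> by (intro fundamental_theorem_of_calculus_interior_strong[of S]) auto
  have le: "\<bar>k t\<bar> \<le> speed atlas F \<gamma> t" if t: "t \<in> {0..1} - S" for t
  proof -
    have in\<Omega>': "\<gamma> t \<in> \<Omega>" using in\<Omega> t by simp
    have "r (\<gamma> t) * norm (\<gamma>' t) = sqrt ((r (\<gamma> t))\<^sup>2 * (\<gamma>' t \<bullet> \<gamma>' t))"
      using r_pos[OF in\<Omega>'] by (simp add: real_sqrt_mult norm_eq_sqrt_inner)
    also have "\<dots> \<le> sqrt (3 * ((r (\<gamma> t))\<^sup>2 * (\<gamma>' t \<bullet> \<gamma>' t)))"
      by (intro real_sqrt_le_mono) simp
    also have "\<dots> \<le> speed atlas F \<gamma> t"
      unfolding speed_F[of \<gamma> t, OF in\<Omega>' \<gamma>'[OF t]]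
      by (intro real_sqrt_le_mono ind_metric_bounds(1) in\<Omega>')
    finally show ?thesis using bound[OF in\<Omega>', of "\<gamma>' t"] by (simp add: k_def)
  qed
  have "(\<integral>\<^sup>+t. ennreal (norm (k t)) \<partial>lebesgue_on {0..1}) = (\<integral>\<^sup>+t. ennreal (norm (k t)) * indicator {0..1} t \<partial>lborel)"
    by (simp add: nn_integral_restrict_space nn_integral_completion)
  also have "\<dots> \<le> (\<integral>\<^sup>+t. ennreal (speed atlas F \<gamma> t) * indicator {0..1} t \<partial>lborel)"
  proof (rule nn_integral_mono_AE)
    have "AE t in lborel. t \<notin> S"
      using finite_imp_null_set_lborel[OF \<open>finite S\<close>] by (rule AE_not_in)
    then show "AE t in lborel. ennreal (norm (k t)) * indicator {0..1} t
        \<le> ennreal (speed atlas F \<gamma> t) * indicator {0..1} t"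
    proof eventually_elim
      case (elim t)
      then show ?case
        using le[of t] by (auto simp: indicator_def intro!: ennreal_leI)
    qed
  qed
  also have "\<dots> = curve_length atlas F \<gamma>"
    by (simp add: curve_length_def)
  finally have nn: "(\<integral>\<^sup>+t. ennreal (norm (k t)) \<partial>lebesgue_on {0..1}) \<le> curve_length atlas F \<gamma>" .
  have "k \<in> borel_measurable (lebesgue_on {0..1})"
    using k integrable_imp_measurable by blast
  moreover have "curve_length atlas F \<gamma> < \<infinity>"
    using False by (simp add: less_top)
  ultimately have int: "integrable (lebesgue_on {0..1}) k"
    using nn by (intro integrableI_bounded) auto
  then have "(k has_integral (integral\<^sup>L (lebesgue_on {0..1}) k)) {0..1}"
    by (intro has_integral_integral_lebesgue_on) auto
  then have "\<psi> (\<gamma> 1) - \<psi> (\<gamma> 0) = integral\<^sup>L (lebesgue_on {0..1}) k"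
    using k has_integral_unique by blast
  then have "ennreal \<bar>\<psi> (\<gamma> 1) - \<psi> (\<gamma> 0)\<bar> \<le> (\<integral>\<^sup>+t. ennreal (norm (k t)) \<partial>lebesgue_on {0..1})"
    using integral_norm_bound_ennreal[OF int] by simp
  then show ?thesis using nn by simp
qed

lemma convergent_of_lipschitz:
  assumes der: "\<And>x. x \<in> \<Omega> \<Longrightarrow> (\<psi> has_derivative D x) (at x)"
    and bound: "\<And>x v. x \<in> \<Omega> \<Longrightarrow> \<bar>D x v\<bar> \<le> C * (r x * norm v)" and "C > 0"
    and cauchy: "\<And>\<epsilon>. \<epsilon> > 0 \<Longrightarrow> \<exists>k. \<forall>i\<ge>k. \<forall>j\<ge>k. riemannian_dist (top_of_set \<Omega>) atlas F (\<sigma> i) (\<sigma> j) < \<epsilon>"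
  shows "convergent (\<lambda>i::nat. \<psi> (\<sigma> i))"
proof -
  have "\<exists>M. \<forall>m\<ge>M. \<forall>n\<ge>M. norm (\<psi> (\<sigma> m) - \<psi> (\<sigma> n)) < e" if "e > 0" for e
  proof -
    obtain k where k: "\<And>i j. i \<ge> k \<Longrightarrow> j \<ge> k \<Longrightarrow> riemannian_dist (top_of_set \<Omega>) atlas F (\<sigma> i) (\<sigma> j) < ennreal (e / C)"
      using cauchy[of "ennreal (e / C)"] \<open>e > 0\<close> \<open>C > 0\<close> by auto
    have "norm (\<psi> (\<sigma> m) - \<psi> (\<sigma> n)) < e" if mn: "m \<ge> k" "n \<ge> k" for m n
    proof -
      obtain \<gamma> where \<gamma>: "piecewise_C1_curve (top_of_set \<Omega>) atlas \<gamma>" "\<gamma> 0 = \<sigma> m" "\<gamma> 1 = \<sigma> n"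
        and len: "curve_length atlas F \<gamma> < ennreal (e / C)"
        using k[OF mn] unfolding riemannian_dist_def INF_less_iff by auto
      have "ennreal \<bar>\<psi> (\<gamma> 1) / C - \<psi> (\<gamma> 0) / C\<bar> \<le> curve_length atlas F \<gamma>"
      proof (rule curve_length_ge[OF _ _ \<gamma>(1)])
        show "((\<lambda>x. \<psi> x / C) has_derivative (\<lambda>v. D x v / C)) (at x)" if "x \<in> \<Omega>" for x
          using bounded_linear.has_derivative[OF bounded_linear_divide der[OF that]] .
        show "\<bar>D x v / C\<bar> \<le> r x * norm v" if "x \<in> \<Omega>" for x v
          using bound[OF that, of v] \<open>C > 0\<close> by (simp add: pos_divide_le_eq mult.commute)
      qed
      also have "\<dots> < ennreal (e / C)" by (rule len)
      finally have "\<bar>\<psi> (\<sigma> n) / C - \<psi> (\<sigma> m) / C\<bar> < e / C"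
        using \<gamma> \<open>C > 0\<close> \<open>e > 0\<close> by (simp add: ennreal_less_iff)
      then show ?thesis
        using \<open>C > 0\<close> by (simp add: diff_divide_distrib[symmetric] divide_less_cancel abs_minus_commute)
    qed
    then show ?thesis by blast
  qed
  then have "Cauchy (\<lambda>i. \<psi> (\<sigma> i))" by (rule CauchyI)
  then show ?thesis by (rule Cauchy_convergent)
qed

text \<open>Along the straight segment |y| stays at least half its value at p, so r is at most
  \<open>2 * r p\<close>. The upper metric bound contributes the other factor sqrt 4 = 2.\<close>

lemma riemannian_dist_le:
  assumes p: "p \<in> \<Omega>" and near: "norm (q - p) \<le> norm (P p) / 2"
  shows "riemannian_dist (top_of_set \<Omega>) atlas F q p \<le> ennreal (4 * r p * norm (q - p))"
proof -
  define \<gamma> where "\<gamma> t = q + t *\<^sub>R (p - q)" for t :: real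
  have \<gamma>_P: "norm (P p) / 2 \<le> norm (P (\<gamma> t))" if t: "t \<in> {0..1}" for t
  proof -
    have "\<gamma> t - p = (1 - t) *\<^sub>R (q - p)" by (simp add: \<gamma>_def algebra_simps)
    then have "norm (\<gamma> t - p) \<le> norm (q - p)" using t by (simp add: mult_left_le_one_le)
    then have "norm (P (\<gamma> t) - P p) \<le> norm (P p) / 2"
      using norm_P_le[of "\<gamma> t - p"] near by (simp add: linear_diff[OF linear_P])
    then show ?thesis using norm_triangle_ineq2[of "P p" "P (\<gamma> t)"] by (simp add: norm_minus_commute)
  qed
  have nP: "norm (P p) > 0" using p by (simp add: Omega_def)
  have in\<Omega>: "\<gamma> t \<in> \<Omega>" if "t \<in> {0..1}" for t
    using \<gamma>_P[OF that] nP by (auto simp: Omega_def)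
  have r_le: "r (\<gamma> t) \<le> 2 * r p" if "t \<in> {0..1}" for t
    using le_imp_inverse_le[OF \<gamma>_P[OF that]] nP by (simp add: r_def inverse_eq_divide)
  have der: "(\<gamma> has_vector_derivative (p - q)) (at t)" for t
    unfolding \<gamma>_def by (auto intro!: derivative_eq_intros)
  have "piecewise_C1_curve (top_of_set \<Omega>) atlas \<gamma>"
    unfolding piecewise_C1_curve_def
  proof (intro conjI exI[of _ "{}"])
    have "continuous_on {0..1} \<gamma>" unfolding \<gamma>_def by (intro continuous_intros)
    then show "continuous_map (top_of_set {0..1}) (top_of_set \<Omega>) \<gamma>"
      using in\<Omega> by auto
    show "\<forall>(U, \<phi>)\<in>atlas. (\<phi> \<circ> \<gamma>) C1_differentiable_on {t \<in> {0..1} - {}. \<gamma> t \<in> U}"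
      using der by (auto simp: C1_differentiable_on_def intro!: exI[of _ "\<lambda>t. p - q"])
  qed simp
  then have "riemannian_dist (top_of_set \<Omega>) atlas F q p \<le> curve_length atlas F \<gamma>"
    unfolding riemannian_dist_def by (intro INF_lower) (simp add: \<gamma>_def)
  also have "\<dots> \<le> (\<integral>\<^sup>+t. ennreal (4 * r p * norm (q - p)) * indicator {0..1::real} t \<partial>lborel)"
    unfolding curve_length_def
  proof (intro nn_integral_mono)
    fix t :: real
    have "speed atlas F \<gamma> t \<le> 4 * r p * norm (q - p)" if t: "t \<in> {0..1}"
    proof -
      have "speed atlas F \<gamma> t \<le> sqrt (4 * ((r (\<gamma> t))\<^sup>2 * ((p - q) \<bullet> (p - q))))"
        unfolding speed_F[of \<gamma> t, OF in\<Omega>[OF t] der]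
        by (intro real_sqrt_le_mono ind_metric_bounds(2) in\<Omega> t)
      also have "\<dots> = 2 * r (\<gamma> t) * norm (q - p)"
        using r_pos[OF in\<Omega>[OF t]] 
        by (simp add: real_sqrt_mult norm_eq_sqrt_inner[symmetric] norm_minus_commute)
      also have "\<dots> \<le> 2 * (2 * r p) * norm (q - p)"
        by (intro mult_right_mono mult_left_mono r_le t) auto
      finally show ?thesis by simp
    qed
    then show "ennreal (speed atlas F \<gamma> t) * indicator {0..1} t
        \<le> ennreal (4 * r p * norm (q - p)) * indicator {0..1} t"
      by (auto simp: indicator_def intro: ennreal_leI)
  qed
  also have "\<dots> = ennreal (4 * r p * norm (q - p))"
    by (simp add: nn_integral_cmult_indicator)
  finally show ?thesis .
qed

lemma norm_le_one_plus_sq: "norm x \<le> 1 + x \<bullet> x" for x :: "'a::real_inner"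
proof -
  have "0 \<le> (norm x - 1)\<^sup>2" by simp
  then have "2 * norm x \<le> 1 + x \<bullet> x" by (simp add: power2_diff power2_norm_eq_inner)
  then show ?thesis using norm_ge_zero[of x] by linarith
qed

lemma inverse_one_plus_sq_le: "x \<in> \<Omega> \<Longrightarrow> 1 / (1 + x \<bullet> x) \<le> r x"
proof -
  assume "x \<in> \<Omega>"
  then have "0 < norm (P x)" by (simp add: Omega_def)
  moreover have "norm (P x) \<le> 1 + x \<bullet> x" using norm_P_le norm_le_one_plus_sq order_trans by blast
  ultimately show ?thesis by (simp add: r_def inverse_eq_divide frac_le)
qed

text \<open>The coordinates have unbounded gradient, but \<open>ln r\<close>, \<open>ln (1 + \<bar>x\<bar>\<^sup>2)\<close> and \<open>x\<^sub>j / (1 + \<bar>x\<bar>\<^sup>2)\<close> are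
  Lipschitz for the induced distance, and their limits determine a limit point with \<open>P x \<noteq> 0\<close>.\<close>

lemma complete_induced_metric_F: "complete_induced_metric (top_of_set \<Omega>) atlas F"
  unfolding complete_induced_metric_def
proof (intro allI impI)
  fix \<sigma> :: "nat \<Rightarrow> real ^ 'n"
  let ?d = "riemannian_dist (top_of_set \<Omega>) atlas F"
  assume "range \<sigma> \<subseteq> topspace (top_of_set \<Omega>) \<and> (\<forall>\<epsilon>>0. \<exists>k. \<forall>i\<ge>k. \<forall>j\<ge>k. ?d (\<sigma> i) (\<sigma> j) < \<epsilon>)"
  then have \<sigma>: "\<And>i. \<sigma> i \<in> \<Omega>" and cauchy: "\<And>\<epsilon>. \<epsilon> > 0 \<Longrightarrow> \<exists>k. \<forall>i\<ge>k. \<forall>j\<ge>k. ?d (\<sigma> i) (\<sigma> j) < \<epsilon>"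
    by auto
  have pos: "1 + x \<bullet> x > 0" for x :: "real ^ 'n" by (simp add: add_pos_nonneg)
  have cs: "\<bar>x \<bullet> v\<bar> \<le> norm x * norm v" for x v :: "real ^ 'n" by (rule Cauchy_Schwarz_ineq2)
  have "convergent (\<lambda>i. ln (r (\<sigma> i)))"
  proof (rule convergent_of_lipschitz[where C = 1 and D = "\<lambda>x v. - ((r x)\<^sup>2 * (P x \<bullet> v))", OF _ _ _ cauchy])
    fix x assume x: "x \<in> \<Omega>"
    show "((\<lambda>x. ln (r x)) has_derivative (\<lambda>v. - ((r x)\<^sup>2 * (P x \<bullet> v)))) (at x)"
      using r_pos[OF x] by (auto intro!: derivative_eq_intros has_derivative_r[OF x]
          simp: fun_eq_iff power2_eq_square power3_eq_cube)
    fix v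
    have "(r x)\<^sup>2 * \<bar>P x \<bullet> v\<bar> \<le> (r x)\<^sup>2 * (norm (P x) * norm v)"
      by (intro mult_left_mono cs) simp
    also have "\<dots> = (r x * norm (P x)) * (r x * norm v)" by (simp add: power2_eq_square)
    finally show "\<bar>- ((r x)\<^sup>2 * (P x \<bullet> v))\<bar> \<le> 1 * (r x * norm v)"
      by (simp add: r_norm_P[OF x] abs_mult)
  qed simp
  then obtain a where a: "(\<lambda>i. ln (r (\<sigma> i))) \<longlonglongrightarrow> a" by (auto simp: convergent_def)
  have "convergent (\<lambda>i. ln (1 + \<sigma> i \<bullet> \<sigma> i))"
  proof (rule convergent_of_lipschitz[where C = 2 and D = "\<lambda>x v. 2 * (x \<bullet> v) / (1 + x \<bullet> x)", OF _ _ _ cauchy])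
    fix x assume x: "x \<in> \<Omega>"
    show "((\<lambda>x. ln (1 + x \<bullet> x)) has_derivative (\<lambda>v. 2 * (x \<bullet> v) / (1 + x \<bullet> x))) (at x)"
      using pos[of x] by (auto intro!: derivative_eq_intros simp: fun_eq_iff inner_commute field_simps)
    fix v
    \<comment> \<open>Multiplying by r = 1 / |y| turns |y| |x| <= 1 + |x|^2 into |x| <= r (1 +
      |x|^2), which is the gradient bound for the logarithm.\<close>
    have "norm (P x) * norm x \<le> norm x * norm x"
      by (intro mult_right_mono norm_P_le) simp
    then have "r x * (norm (P x) * norm x) \<le> r x * (1 + x \<bullet> x)"
      using r_pos[OF x] by (intro mult_left_mono) (auto simp: power2_norm_eq_inner[symmetric] power2_eq_square)
    then have 1: "norm x \<le> r x * (1 + x \<bullet> x)"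
      using r_norm_P[OF x] by (simp flip: mult.assoc)
    have "\<bar>x \<bullet> v\<bar> \<le> (r x * (1 + x \<bullet> x)) * norm v"
      using cs[of x v] mult_right_mono[OF 1, of "norm v"] by simp
    then show "\<bar>2 * (x \<bullet> v) / (1 + x \<bullet> x)\<bar> \<le> 2 * (r x * norm v)"
      using pos[of x] by (simp add: abs_mult field_simps)
  qed simp
  then obtain b where b: "(\<lambda>i. ln (1 + \<sigma> i \<bullet> \<sigma> i)) \<longlonglongrightarrow> b" by (auto simp: convergent_def)
  have "convergent (\<lambda>i. \<sigma> i $ j / (1 + \<sigma> i \<bullet> \<sigma> i))" for j
  proof (rule convergent_of_lipschitz[where C = 3 and D = "\<lambda>x v. v $ j / (1 + x \<bullet> x) - x $ j * (2 * (x \<bullet> v)) / (1 + x \<bullet> x)\<^sup>2", OF _ _ _ cauchy])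
    fix x assume x: "x \<in> \<Omega>"
    have nth: "((\<lambda>x. x $ j) has_derivative (\<lambda>v. v $ j)) (at x)" for x :: "real ^ 'n"
      by (rule bounded_linear_imp_has_derivative[OF bounded_linear_vec_nth])
    show "((\<lambda>x. x $ j / (1 + x \<bullet> x)) has_derivative (\<lambda>v. v $ j / (1 + x \<bullet> x) - x $ j * (2 * (x \<bullet> v)) / (1 + x \<bullet> x)\<^sup>2)) (at x)"
    proof -
      have "((\<lambda>x. 1 + x \<bullet> x) has_derivative (\<lambda>v. 2 * (x \<bullet> v))) (at x)"
        by (auto intro!: derivative_eq_intros simp: inner_commute)
      from has_derivative_divide'[OF nth this] show ?thesis
        using pos[of x] by (simp add: diff_divide_distrib power2_eq_square)
    qed
    fix v
    have "\<bar>x $ j * (2 * (x \<bullet> v))\<bar> \<le> norm x * (2 * (norm x * norm v))"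
      unfolding abs_mult by (intro mult_mono component_le_norm_cart cs) auto
    also have "\<dots> = 2 * (x \<bullet> x) * norm v" by (simp add: power2_norm_eq_inner[symmetric] power2_eq_square)
    also have "\<dots> \<le> 2 * (1 + x \<bullet> x) * norm v" by (intro mult_right_mono) auto
    finally have "\<bar>x $ j * (2 * (x \<bullet> v)) / (1 + x \<bullet> x)\<^sup>2\<bar> \<le> 2 * (1 + x \<bullet> x) * norm v / (1 + x \<bullet> x)\<^sup>2"
      by (simp add: divide_right_mono)
    also have "\<dots> = 2 * (norm v / (1 + x \<bullet> x))"
    proof -
      have "2 * a * norm v / a\<^sup>2 = 2 * (norm v / a)" if "a > 0" for a
        using that by (simp add: power2_eq_square)
      from this[OF pos[of x]] show ?thesis .
    qed
    finally have 1: "\<bar>x $ j * (2 * (x \<bullet> v)) / (1 + x \<bullet> x)\<^sup>2\<bar> \<le> 2 * (norm v / (1 + x \<bullet> x))" .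
    have 2: "\<bar>v $ j / (1 + x \<bullet> x)\<bar> \<le> norm v / (1 + x \<bullet> x)"
      using pos[of x] component_le_norm_cart[of v j] by (simp add: divide_right_mono)
    have 3: "norm v / (1 + x \<bullet> x) \<le> r x * norm v"
      using mult_right_mono[OF inverse_one_plus_sq_le[OF x], of "norm v"] by simp
    show "\<bar>v $ j / (1 + x \<bullet> x) - x $ j * (2 * (x \<bullet> v)) / (1 + x \<bullet> x)\<^sup>2\<bar> \<le> 3 * (r x * norm v)"
      using abs_triangle_ineq4 1 2 3 by (smt (verit))
  qed simp
  then obtain c where c: "\<And>j. (\<lambda>i. \<sigma> i $ j / (1 + \<sigma> i \<bullet> \<sigma> i)) \<longlonglongrightarrow> c j"
    unfolding convergent_def by metis
  \<comment> \<open>The quotients tend to c and 1 + |x|^2 tends to exp b, so the coordinates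
    themselves tend to the products.\<close>
  define p where "p = (\<chi> j. c j * exp b)"
  have "(\<lambda>i. \<sigma> i $ j) \<longlonglongrightarrow> p $ j" for j
  proof -
    have "(\<lambda>i. \<sigma> i $ j / (1 + \<sigma> i \<bullet> \<sigma> i) * exp (ln (1 + \<sigma> i \<bullet> \<sigma> i))) \<longlonglongrightarrow> c j * exp b"
      by (intro tendsto_intros c b)
    moreover have "\<sigma> i $ j / (1 + \<sigma> i \<bullet> \<sigma> i) * exp (ln (1 + \<sigma> i \<bullet> \<sigma> i)) = \<sigma> i $ j" for i
      using pos[of "\<sigma> i"] by simp
    ultimately show ?thesis by (simp add: p_def)
  qed
  then have \<sigma>p: "\<sigma> \<longlonglongrightarrow> p" by (rule vec_tendstoI)
  have "(\<lambda>i. norm (P (\<sigma> i))) \<longlonglongrightarrow> norm (P p)"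
    by (intro tendsto_norm bounded_linear.tendsto[OF bounded_linear_P] \<sigma>p)
  moreover have "(\<lambda>i. exp (ln (r (\<sigma> i)))) \<longlonglongrightarrow> exp a" by (intro tendsto_intros a)
  then have "(\<lambda>i. r (\<sigma> i)) \<longlonglongrightarrow> exp a" using r_pos[OF \<sigma>] by simp
  ultimately have "(\<lambda>i. r (\<sigma> i) * norm (P (\<sigma> i))) \<longlonglongrightarrow> exp a * norm (P p)"
    by (intro tendsto_mult)
  \<comment> \<open>The finite limit of \<open>ln r\<close> keeps |y| away from 0, so p does not lie
    on the removed subspace.\<close>
  then have "exp a * norm (P p) = 1"
    using r_norm_P[OF \<sigma>] by (simp add: LIMSEQ_const_iff)
  then have p: "p \<in> \<Omega>" by (auto simp: Omega_def)
  have lim: "(\<lambda>i. norm (\<sigma> i - p)) \<longlonglongrightarrow> 0"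
    using \<sigma>p tendsto_norm_zero LIM_zero by blast
  have "norm (P p) / 2 > 0" using p by (simp add: Omega_def)
  then have "\<forall>\<^sub>F i in sequentially. norm (\<sigma> i - p) < norm (P p) / 2"
    using order_tendstoD(2)[OF lim] by blast
  then have "\<forall>\<^sub>F i in sequentially. ?d (\<sigma> i) p \<le> ennreal (4 * r p * norm (\<sigma> i - p))"
    by eventually_elim (rule riemannian_dist_le[OF p], simp)
  moreover from tendsto_ennrealI[OF tendsto_mult_left[OF lim, of "4 * r p"]]
  have "(\<lambda>i. ennreal (4 * r p * norm (\<sigma> i - p))) \<longlonglongrightarrow> 0" by simp
  ultimately have "(\<lambda>i. ?d (\<sigma> i) p) \<longlonglongrightarrow> 0"
    by (rule tendsto_sandwich[OF always_eventually[OF allI[OF zero_le]] _ tendsto_const])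
  then show "\<exists>p\<in>topspace (top_of_set \<Omega>). (\<lambda>i. ?d (\<sigma> i) p) \<longlonglongrightarrow> 0"
    using p by auto
qed

lemma exists_complete_stable_cmc_embedding:
  assumes card: "card I = 4" "card (- I) = 2"
  shows "\<exists>(X :: (real ^ 'n) topology) (\<A> :: (real ^ 'n, 'n) chart set)
           (F :: real ^ 'n \<Rightarrow> real \<times> 'e) (N :: real ^ 'n \<Rightarrow> real \<times> 'e) (H :: real).
           smooth_manifold X \<A> \<and> connected_space X \<and> \<not> compact_space X \<and>
           smooth_embedding X \<A> F \<and> unit_normal X \<A> F N \<and>
           complete_induced_metric X \<A> F \<and>
           (\<forall>p\<in>topspace X. mean_curvature \<A> F N p = H) \<and>
           strongly_stable X \<A> F N \<and>
           H\<^sup>2 = 49 / 48"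
proof -
  obtain i j where ij: "i \<in> I" "j \<in> I" "i \<noteq> j"
  proof -
    have "\<not> card I \<le> Suc 0" using card by simp
    then show thesis using card_le_Suc0_iff_eq[of I] that by auto
  qed
  have "connected_space (top_of_set \<Omega>)"
    using connected_Omega[OF ij] by (simp add: connected_space_subtopology)
  moreover have "\<not> compact_space (top_of_set \<Omega>)"
    using not_compact_Omega[OF ij(1)] by (simp add: compact_space_def compactin_subtopology)
  moreover have "\<forall>p\<in>topspace (top_of_set \<Omega>). mean_curvature atlas F N p = 7 * sqrt 3 / 12"
    using mean_curvature_F[OF _ card] by simp
  moreover have "(7 * sqrt 3 / 12)\<^sup>2 = (49 / 48 :: real)"
    by (simp add: power_divide power_mult_distrib)
  ultimately show ?thesis
    using smooth_manifold_open[OF open_Omega] smooth_embedding_F unit_normal_N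
      complete_induced_metric_F strongly_stable_F[OF card] by blast
qed

end

theorem corollary7p3:
  shows "\<exists>(X :: (real ^ 6) topology) (\<A> :: (real ^ 6, 6) chart set)
           (F :: real ^ 6 \<Rightarrow> real \<times> (real ^ 7)) (N :: real ^ 6 \<Rightarrow> real \<times> (real ^ 7)) (H :: real).
           smooth_manifold X \<A> \<and> connected_space X \<and> \<not> compact_space X \<and>
           smooth_embedding X \<A> F \<and> unit_normal X \<A> F N \<and>
           complete_induced_metric X \<A> F \<and>
           (\<forall>p\<in>topspace X. mean_curvature \<A> F N p = H) \<and>
           strongly_stable X \<A> F N \<and>
           H\<^sup>2 = 49 / 48"
proof -
  obtain I :: "6 set" where I: "card I = 4"
    using obtain_subset_with_card_n[of 4 "UNIV :: 6 set"] by auto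
  have I': "card (- I) = 2" by (simp add: Compl_eq_Diff_UNIV card_Diff_subset I)
  \<comment> \<open>Six of the seven spatial axes carry the image of \<open>E\<close>; an axis
    outside the range of the injection serves as \<open>e\<close>.\<close>
  obtain \<iota> :: "6 \<Rightarrow> 7" where \<iota>: "inj \<iota>"
    using card_le_inj[of "UNIV :: 6 set" "UNIV :: 7 set"] by auto
  have "\<iota> ` UNIV \<noteq> UNIV" 
  proof
    assume "range \<iota> = UNIV"
    then show False using card_image[OF \<iota>] by simp
  qed
  then obtain k where k: "k \<notin> range \<iota>" by blast
  define E :: "real ^ 6 \<Rightarrow> real ^ 7" where "E x = (\<Sum>i\<in>UNIV. x $ i *\<^sub>R axis (\<iota> i) 1)" for x
  interpret hyperbolic_tube I E "axis k 1"
  proof (rule hyperbolic_tube.intro)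
    show "linear E"
      by (rule linearI) (simp_all add: E_def scaleR_left_distrib sum.distrib scaleR_sum_right)
    have E_axis: "E x \<bullet> axis (\<iota> i) 1 = x $ i" for x i
      using \<iota> by (simp add: E_def inner_sum_left inner_axis_axis inj_eq if_distrib cong: if_cong)
    show "E x \<bullet> E y = x \<bullet> y" for x y
      unfolding E_def[of y] inner_sum_right inner_scaleR_right E_axis
      by (simp add: inner_vec_def mult.commute)
    show "(axis k 1 :: real ^ 7) \<bullet> axis k 1 = 1" by (simp add: inner_axis_axis)
    show "E x \<bullet> axis k 1 = 0" for x
      unfolding E_def inner_sum_left
      by (rule sum.neutral) (use k in \<open>auto simp: inner_axis_axis\<close>)
  qed
  show ?thesis by (rule exists_complete_stable_cmc_embedding[OF I I'])
qed

end
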